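(* Let $d\ge 3$ be an integer, $e\in K$ a primitive $d$-th root of $1$, and $a$ an integer with $2\le a\le d-1$. Let $I\subset K[x,y,z]$ be the GT-system generated by all monomials of degree $d$ which are invariant under the action of $M_a=\begin{pmatrix}1&0&0\\0&e&0\\0&0&e^a\end{pmatrix}$. Then $I$ is a minimal Togliatti system.
   Context: $K$ is an algebraically closed field of characteristic zero and $R=K[x,y,z]$. The matrix $M_a$ acts on $R$ by $x\mapsto x$, $y\mapsto e y$, $z\mapsto e^a z$. A homogeneous artinian ideal $I\subset R$ generated by $r\le d+1$ forms of degree $d$ is a Togliatti system if for every linear form $L$ the multiplication map $\times L:(R/I)_{d-1}\to(R/I)_d$ does not have maximal rank; it is a monomial Togliatti system if moreover it is generated by monomials. A monomial Togliatti system with minimal monomial generators $m_1,\dots,m_r$ is minimal if no proper subset of $\{m_1,\dots,m_r\}$ generates a monomial Togliatti system. A GT-system is a Togliatti system generated by all forms of degree $d$ invariant under a diagonal representation of $\mathbb{Z}/d\mathbb{Z}$, whose associated morphism from $\mathbb{P}^2$ (given by a minimal set of generators) is a Galois covering of its image with cyclic Galois group $\mathbb{Z}/d\mathbb{Z}$. *)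

theory Defs
  imports Complex_Main "HOL-Library.Poly_Mapping" "HOL-Computational_Algebra.Polynomial"
begin

section \<open>The polynomial ring in three variables\<close>

datatype var = X | Y | Z

lemma UNIV_var: "UNIV = {X, Y, Z}"
  using var.exhaust by blast

instance var :: finite
  by standard (simp add: UNIV_var)

text \<open>
  Exponent vectors are finitely supported maps from the variables to the naturals, and polynomials
  are finitely supported maps from exponent vectors to coefficients, with convolution as product.
\<close>

type_synonym expo = "var \<Rightarrow>\<^sub>0 nat"
type_synonym 'k poly3 = "expo \<Rightarrow>\<^sub>0 'k"

definition expo_deg :: "expo \<Rightarrow> nat" where
  "expo_deg m = (\<Sum>v\<in>UNIV. Poly_Mapping.lookup m v)"

definition const :: "'k::comm_ring_1 \<Rightarrow> 'k poly3" where
  "const c = Poly_Mapping.single 0 c"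

definition monomial :: "expo \<Rightarrow> 'k::comm_ring_1 poly3" where
  "monomial m = Poly_Mapping.single m 1"

definition variable :: "var \<Rightarrow> 'k::comm_ring_1 poly3" where
  "variable v = monomial (Poly_Mapping.single v 1)"

text \<open>
  The forms of degree \<^term>\<open>n\<close>, including 0; that is, the graded piece $R_n$.
\<close>

definition forms :: "nat \<Rightarrow> 'k::comm_ring_1 poly3 set" where
  "forms n = {p. \<forall>m\<in>Poly_Mapping.keys p. expo_deg m = n}"

text \<open>
  The \<open>'k\<close>-algebra endomorphism sending each variable \<^term>\<open>v\<close> to \<^term>\<open>f v\<close>.
\<close>

definition subst_vars :: "(var \<Rightarrow> 'k::comm_ring_1 poly3) \<Rightarrow> 'k poly3 \<Rightarrow> 'k poly3" where
  "subst_vars f p =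
     (\<Sum>m\<in>Poly_Mapping.keys p.
        const (Poly_Mapping.lookup p m) * (\<Prod>v\<in>UNIV. f v ^ Poly_Mapping.lookup m v))"


section \<open>Ideals\<close>

text \<open>
  Ideals of a commutative ring are its submodules when it is regarded as a module over itself.
\<close>

definition is_ideal :: "'a::comm_ring_1 set \<Rightarrow> bool" where
  "is_ideal I \<longleftrightarrow> module.subspace (*) I"

definition ideal_gen :: "'a::comm_ring_1 set \<Rightarrow> 'a set" where
  "ideal_gen S = module.span (*) S"

text \<open>
  The quotient by \<^term>\<open>I\<close> is an artinian ring: its ideals, which correspond to the ideals
  containing \<^term>\<open>I\<close>, satisfy the descending chain condition.
\<close>

definition artinian_ideal :: "'a::comm_ring_1 set \<Rightarrow> bool" where
  "artinian_ideal I \<longleftrightarrow> is_ideal I \<and>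
     (\<forall>J :: nat \<Rightarrow> 'a set.
        (\<forall>n. is_ideal (J n) \<and> I \<subseteq> J n \<and> J (Suc n) \<subseteq> J n) \<longrightarrow>
        (\<exists>N. \<forall>n\<ge>N. J n = J N))"


section \<open>Multiplication maps between graded pieces of the quotient\<close>

text \<open>
  For a homogeneous ideal \<^term>\<open>I\<close>, the graded piece $(R/I)_n$ is $R_n/(I \cap R_n)$, realised
  as the set of classes of forms of degree \<^term>\<open>n\<close> modulo \<^term>\<open>I\<close>.
\<close>

definition cong_forms :: "'k::comm_ring_1 poly3 set \<Rightarrow> nat \<Rightarrow> ('k poly3 \<times> 'k poly3) set" where
  "cong_forms I n = {(p, q). p \<in> forms n \<and> q \<in> forms n \<and> p - q \<in> I}"

definition quot_piece :: "'k::comm_ring_1 poly3 set \<Rightarrow> nat \<Rightarrow> 'k poly3 set set" where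
  "quot_piece I n = forms n // cong_forms I n"

text \<open>
  Multiplication by the linear form \<^term>\<open>L\<close> as a map $(R/I)_n \to (R/I)_{n+1}$. The union is
  over equal classes, since the class of \<open>L * p\<close> does not depend on the representative \<open>p\<close>.
\<close>

definition mult_map ::
    "'k::comm_ring_1 poly3 set \<Rightarrow> nat \<Rightarrow> 'k poly3 \<Rightarrow> 'k poly3 set \<Rightarrow> 'k poly3 set" where
  "mult_map I n L c = (\<Union>p\<in>c. cong_forms I (Suc n) `` {L * p})"

definition mult_max_rank :: "'k::comm_ring_1 poly3 set \<Rightarrow> nat \<Rightarrow> 'k poly3 \<Rightarrow> bool" where
  "mult_max_rank I n L \<longleftrightarrow>
     inj_on (mult_map I n L) (quot_piece I n) \<or>
     mult_map I n L ` quot_piece I n = quot_piece I (Suc n)"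


section \<open>Togliatti systems\<close>

definition togliatti_system :: "nat \<Rightarrow> 'k::field poly3 set \<Rightarrow> bool" where
  "togliatti_system d I \<longleftrightarrow>
     0 < d \<and>
     (\<exists>F. finite F \<and> card F \<le> d + 1 \<and> F \<subseteq> forms d \<and> I = ideal_gen F) \<and>
     artinian_ideal I \<and>
     (\<forall>L\<in>forms 1. \<not> mult_max_rank I (d - 1) L)"

definition monomial_togliatti_system :: "nat \<Rightarrow> 'k::field poly3 set \<Rightarrow> bool" where
  "monomial_togliatti_system d I \<longleftrightarrow>
     togliatti_system d I \<and> (\<exists>M \<subseteq> range monomial. I = ideal_gen M)"

definition minimal_monomial_generators :: "'k::field poly3 set \<Rightarrow> 'k poly3 set \<Rightarrow> bool" where
  "minimal_monomial_generators M I \<longleftrightarrow>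
     M \<subseteq> range monomial \<and> ideal_gen M = I \<and> (\<forall>N. N \<subset> M \<longrightarrow> ideal_gen N \<noteq> I)"

text \<open>
  A monomial ideal has exactly one minimal set of monomial generators, so the existential
  quantifier below merely names it.
\<close>

definition minimal_togliatti_system :: "nat \<Rightarrow> 'k::field poly3 set \<Rightarrow> bool" where
  "minimal_togliatti_system d I \<longleftrightarrow>
     monomial_togliatti_system d I \<and>
     (\<exists>M. minimal_monomial_generators M I \<and>
          (\<forall>N. N \<subset> M \<longrightarrow> \<not> monomial_togliatti_system d (ideal_gen N)))"


section \<open>The cyclic diagonal action\<close>

definition primitive_root_of_unity :: "nat \<Rightarrow> 'k::field \<Rightarrow> bool" where
  "primitive_root_of_unity d e \<longleftrightarrow>
     0 < d \<and> e ^ d = 1 \<and> (\<forall>k. 0 < k \<and> k < d \<longrightarrow> e ^ k \<noteq> 1)"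

text \<open>
  The action on polynomials of the diagonal matrix with diagonal entries $1$, $e$, $e^a$.
\<close>

definition M_act :: "'k::comm_ring_1 \<Rightarrow> nat \<Rightarrow> 'k poly3 \<Rightarrow> 'k poly3" where
  "M_act e a = subst_vars (\<lambda>v. case v of
       X \<Rightarrow> variable X
     | Y \<Rightarrow> const e * variable Y
     | Z \<Rightarrow> const (e ^ a) * variable Z)"

text \<open>
  For \<^term>\<open>e\<close> a primitive \<^term>\<open>d\<close>-th root of 1, an invariant form of degree
  \<^term>\<open>d\<close> is a linear combination of invariant monomials, so these generate the same ideal
  as all invariant forms. For $d \ge 3$ and $2 \le a \le d - 1$ this ideal is always a GT-system:
  the invariant monomials of degree $d$ include $x^d$, $y^d$, $z^d$ and $x^{a-1} y^{d-a} z$, whose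
  ratios generate the field of invariants of degree-0 rational functions, so the associated
  morphism is a Galois covering of its image with cyclic group of order $d$.
\<close>

definition GT_ideal :: "nat \<Rightarrow> 'k::comm_ring_1 \<Rightarrow> nat \<Rightarrow> 'k poly3 set" where
  "GT_ideal d e a =
     ideal_gen {p. \<exists>m. p = monomial m \<and> expo_deg m = d \<and> M_act e a p = p}"

end

theory Submission
  imports Defs "Jordan_Normal_Form.Determinant"
begin

text \<open>
  Let \<open>P = \<Prod>\<^sub>i (u x + e\<^sup>i v y + e\<^sup>a\<^sup>i w z)\<close> be the product of the orbit of a linear form \<open>L\<close>.
  It is invariant of degree \<open>d\<close>, so \<open>P / L\<close> spoils injectivity of multiplication by \<open>L\<close>, and since
  there are at most \<open>d + 1\<close> generators also surjectivity. For minimality take \<open>L = x + y + z\<close>: if all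
  monomials of \<open>L f\<close> are invariant, then \<open>L f\<close> vanishes on every line of the orbit of \<open>L\<close>, hence
  is a multiple of \<open>P\<close>. It remains to see that every invariant monomial occurs in \<open>P\<close>. Now \<open>P\<close> is
  the determinant of a circulant matrix with three nonzero lines, that is, a signed count of permutations
  with steps \<open>0\<close>, \<open>1\<close>, \<open>a\<close>. The permutations that contribute to a given monomial all have the same sign,
  and there is at least one of them.
\<close>

section \<open>Signs of permutations with three step lengths\<close>

text \<open>Expanding \<open>P\<close> for \<open>x + y + z\<close> directly gives each coefficient
  as a sum of powers of \<open>e\<close> that might cancel. The determinant shows that it is an
  integer, up to sign the number of contributing permutations, hence nonzero in characteristic zero.
  The common sign has a topological reason: the monomial \<open>x^m y^n z^c\<close> prescribes how
  many steps have each length, hence the winding number \<open>w = (n + a c) / d\<close>, and the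
  parity of a permutation turns out to depend only on \<open>a\<close>, \<open>c\<close>,
  \<open>d\<close> and \<open>w\<close>. Invariance of the monomial says exactly that
  \<open>w\<close> is an integer, and the same congruence makes the explicit permutation close up.
  One linear form suffices for minimality: a proper subset of the generators misses a monomial of
  \<open>P\<close>, so the only multiple of \<open>P\<close> supported on it is 0, and
  multiplication by \<open>x + y + z\<close> is injective.\<close>

definition inversion_sign :: "nat \<Rightarrow> (nat \<Rightarrow> nat) \<Rightarrow> int" where
  "inversion_sign n p = (\<Prod>(i, j)\<in>{(i, j). i < j \<and> j < n}. if p j < p i then -1 else 1)"

lemma finite_index_pairs: "finite {(i, j). i < j \<and> j < (n::nat)}"
  by (rule finite_subset[of _ "{..<n} \<times> {..<n}"]) auto

text \<open>A pair is inverted by the composite when exactly one of two things happens: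
  \<open>q\<close> inverts it, or \<open>p\<close> inverts its image. \<open>Q\<close> sorts the
  image pairs, and these run through all pairs again.\<close>

lemma inversion_sign_compose:
  assumes p: "p permutes {..<n}" and q: "q permutes {..<n}"
  shows "inversion_sign n (p \<circ> q) = inversion_sign n p * inversion_sign n q"
proof -
  let ?P = "{(i, j). i < j \<and> j < n}"
  let ?\<epsilon> = "\<lambda>u v::nat. if v < u then -1 else (1::int)"
  define Q where "Q = (\<lambda>(i, j). (min (q i) (q j), max (q i) (q j)))"
  have q_inj: "q i = q j \<longleftrightarrow> i = j" for i j
    using permutes_inj[OF q] by (auto dest: injD)
  have p_inj: "p i = p j \<longleftrightarrow> i = j" for i j
    using permutes_inj[OF p] by (auto dest: injD)
  have q_less: "q i < n \<longleftrightarrow> i < n" for i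
    using permutes_in_image[OF q, of i] by simp
  have inj: "inj_on Q ?P"
  proof (rule inj_onI, clarify)
    fix i j k l assume *: "i < j" "k < l" "Q (i, j) = Q (k, l)"
    then have "{q i, q j} = {q k, q l}" unfolding Q_def by (auto simp: min_def max_def split: if_splits)
    then have "{i, j} = {k, l}" by (auto simp: doubleton_eq_iff q_inj)
    with * show "i = k \<and> j = l" by (auto simp: doubleton_eq_iff)
  qed
  have sub: "Q ` ?P \<subseteq> ?P"
  proof clarify
    fix i j u v assume "(u, v) = Q (i, j)" "i < j" "j < n"
    then show "u < v \<and> v < n"
      using q_less[of i] q_less[of j] q_inj[of i j] unfolding Q_def by (auto simp: min_def max_def)
  qed
  have bij: "bij_betw Q ?P ?P"
    using inj sub finite_index_pairs endo_inj_surj unfolding bij_betw_def by blast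
  have "inversion_sign n (p \<circ> q)
      = (\<Prod>x\<in>?P. (case Q x of (u, v) \<Rightarrow> ?\<epsilon> (p u) (p v)) * (case x of (i, j) \<Rightarrow> ?\<epsilon> (q i) (q j)))"
    unfolding inversion_sign_def
  proof (rule prod.cong[OF refl], clarify)
    fix i j :: nat assume "i < j"
    then have "q i \<noteq> q j" "p (q i) \<noteq> p (q j)" by (simp_all add: q_inj p_inj)
    then show "?\<epsilon> ((p \<circ> q) i) ((p \<circ> q) j) =
        (case Q (i, j) of (u, v) \<Rightarrow> ?\<epsilon> (p u) (p v)) * ?\<epsilon> (q i) (q j)"
      by (cases "q i < q j") (simp_all add: Q_def min_def max_def)
  qed
  also have "\<dots> = (\<Prod>x\<in>?P. case Q x of (u, v) \<Rightarrow> ?\<epsilon> (p u) (p v)) * inversion_sign n q"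
    unfolding inversion_sign_def by (simp add: prod.distrib)
  also have "(\<Prod>x\<in>?P. case Q x of (u, v) \<Rightarrow> ?\<epsilon> (p u) (p v)) = inversion_sign n p"
    unfolding inversion_sign_def by (rule prod.reindex_bij_betw[OF bij])
  finally show ?thesis .
qed

lemma prod_minus_one_if:
  "finite A \<Longrightarrow> (\<Prod>x\<in>A. if P x then -1 else 1) = (-1 :: 'a::comm_ring_1) ^ card {x \<in> A. P x}"
  by (simp add: prod.If_cases Int_def)

text \<open>Inverted are \<open>(a, b)\<close> and, for each \<open>k\<close> strictly between, both
  \<open>(a, k)\<close> and \<open>(k, b)\<close>: an odd number of pairs.\<close>

lemma inversion_sign_transpose:
  assumes "a < b" "b < n"
  shows "inversion_sign n (Transposition.transpose a b) = -1"
proof -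
  let ?inv = "{x \<in> {(i, j). i < j \<and> j < n}. case x of (i, j) \<Rightarrow> Transposition.transpose a b j < Transposition.transpose a b i}"
  let ?R = "insert (a, b) ({a} \<times> {a<..<b} \<union> {a<..<b} \<times> {b})"
  have "(i, j) \<in> ?inv \<longleftrightarrow> (i, j) \<in> ?R" for i j
    using assms
    by (cases "i = a"; cases "i = b"; cases "j = a"; cases "j = b")
      (simp_all add: Transposition.transpose_def, auto?)
  then have "x \<in> ?inv \<longleftrightarrow> x \<in> ?R" for x
    by (cases x) (simp only:)
  then have "?inv = ?R" by (rule Set.set_eqI)
  moreover have "card (insert (a, b) ({a} \<times> {a<..<b} \<union> {a<..<b} \<times> {b})) = Suc (2 * card {a<..<b})"
    by (subst card_insert_disjoint) (auto simp: card_Un_disjoint Int_def)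
  ultimately have c: "card ?inv = Suc (2 * card {a<..<b})" by simp
  have "inversion_sign n (Transposition.transpose a b) = (-1) ^ card ?inv"
    unfolding inversion_sign_def
    by (subst prod_minus_one_if[OF finite_index_pairs, symmetric]) (simp add: case_prod_unfold)
  then show ?thesis unfolding c by simp
qed

text \<open>Both sides are multiplicative and agree on transpositions. The product form is wanted
  because it lets \<open>p\<close> be compared with its lift pair by pair.\<close>

lemma sign_eq_inversion_sign:
  assumes "p permutes {..<n}"
  shows "sign p = inversion_sign n p"
  using assms finite_lessThan
proof (induction p rule: permutes_induct)
  case id
  have "(\<Prod>(i, j)\<in>{(i, j). i < j \<and> j < n}. if j < i then -1 else 1) = (1::int)"
    by (rule prod.neutral) auto
  then show ?case by (simp add: inversion_sign_def)
next
  case (swap a b p)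
  have t: "Transposition.transpose a b permutes {..<n}"
    using swap by (intro permutes_swap_id)
  have st: "inversion_sign n (Transposition.transpose a b) = sign (Transposition.transpose a b)"
    using inversion_sign_transpose[of a b n] inversion_sign_transpose[of b a n] swap
    by (cases a b rule: linorder_cases) (auto simp: sign_swap_id transpose_commute)
  have "sign (Transposition.transpose a b \<circ> p) = sign (Transposition.transpose a b) * sign p"
    using t swap by (intro sign_compose) (auto simp: permutation_permutes intro!: exI[of _ "{..<n}"])
  also have "\<dots> = inversion_sign n (Transposition.transpose a b \<circ> p)"
    using inversion_sign_compose[OF t \<open>p permutes _\<close>] swap st by simp
  finally show ?case .
qed

section \<open>Winding number and parity of a permutation with steps 0, 1 and
  \<open>a\<close>\<close>

locale three_step_permutation =
  fixes d a :: nat and s p :: "nat \<Rightarrow> nat"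
  assumes a: "2 \<le> a" "a < d"
    and p: "p permutes {..<d}"
    and steps: "\<And>i. i < d \<Longrightarrow> s i \<in> {0, 1, a}"
    and p_eq: "\<And>i. i < d \<Longrightarrow> p i = (i + s i) mod d"
begin

text \<open>The representative of the residue \<open>k\<close> in the window
  \<open>[i, i + d)\<close>.\<close>

definition lift_from :: "nat \<Rightarrow> nat \<Rightarrow> nat" where
  "lift_from i k = (if i \<le> k then k else k + d)"

text \<open>The points whose step leaves the window \<open>[i, i + d)\<close>, that is, crosses the
  cut just before \<open>i\<close>.\<close>

definition crossing :: "nat \<Rightarrow> nat set" where
  "crossing i = {j. j < d \<and> i + d \<le> lift_from i j + s j}"

lemma step_le: "i < d \<Longrightarrow> s i \<le> a"
  using steps[of i] a by auto

lemma p_cases: "j < d \<Longrightarrow> p j = (if j + s j < d then j + s j else j + s j - d)"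
  using p_eq[of j] step_le[of j] a by (auto simp: mod_if)

lemma lift_from_p:
  assumes "i < d" "j < d"
  shows "lift_from i j + s j = lift_from i (p j) + (if j \<in> crossing i then d else 0)"
  using assms p_cases[of j] step_le[of j] a
  by (cases "i \<le> j"; cases "j + s j < d")
    (auto simp: lift_from_def crossing_def)

text \<open>\<open>p\<close> preserves the sum of all representatives, so what the steps add is
  undone by subtracting \<open>d\<close> at each crossing. Hence every cut is crossed equally often:
  this number is the winding number.\<close>

lemma card_crossing:
  assumes "i < d"
  shows "d * card (crossing i) = (\<Sum>j<d. s j)"
proof -
  have "(\<Sum>j<d. lift_from i j) + (\<Sum>j<d. s j)
      = (\<Sum>j<d. lift_from i (p j)) + (\<Sum>j<d. if j \<in> crossing i then d else 0)"
    unfolding sum.distrib[symmetric] using assms by (intro sum.cong) (auto simp: lift_from_p)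
  also have "(\<Sum>j<d. lift_from i (p j)) = (\<Sum>j<d. lift_from i j)"
    using sum.permute[OF p, of "lift_from i"] by (simp add: comp_def)
  also have "(\<Sum>j<d. if j \<in> crossing i then d else 0) = d * card (crossing i)"
  proof -
    have "{j \<in> {..<d}. j \<in> crossing i} = crossing i" by (auto simp: crossing_def)
    then show ?thesis by (simp add: sum.If_cases Int_def)
  qed
  finally show ?thesis by simp
qed

text \<open>Exactly \<open>a\<close> points land in \<open>[i, i + a)\<close> modulo
  \<open>d\<close>. They are the points overtaken by \<open>i\<close> and all points crossing the
  cut at \<open>i\<close>, since no step exceeds \<open>a\<close>; \<open>i\<close> itself lands
  just outside.\<close>

lemma card_overtaken:
  assumes i: "i < d" and si: "s i = a"
  shows "card {j. j < d \<and> j \<noteq> i \<and> lift_from i j + s j < i + a} + card (crossing i) = a"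
proof -
  let ?B = "{j. j < d \<and> j \<noteq> i \<and> lift_from i j + s j < i + a}"
  let ?T = "{j. j < d \<and> lift_from i j < i + a}"
  have "bij_betw p {..<d} {..<d}" by (rule permutes_imp_bij[OF p])
  then have "card {j \<in> {..<d}. lift_from i (p j) < i + a} = card {k \<in> {..<d}. lift_from i k < i + a}"
    by (intro bij_betw_same_card[of p]) (auto simp: bij_betw_def inj_on_def)
  also have "\<dots> = card {i..<i + a}"
  proof (rule bij_betw_same_card[of "lift_from i"], unfold bij_betw_def, intro conjI)
    show "inj_on (lift_from i) {k \<in> {..<d}. lift_from i k < i + a}"
      by (auto simp: inj_on_def lift_from_def split: if_splits)
    show "lift_from i ` {k \<in> {..<d}. lift_from i k < i + a} = {i..<i + a}"
    proof (intro equalityI subsetI)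
      fix x assume "x \<in> {i..<i + a}"
      then have "lift_from i (if x < d then x else x - d) = x" "(if x < d then x else x - d) < d"
        using i a by (auto simp: lift_from_def)
      with \<open>x \<in> _\<close> show "x \<in> lift_from i ` {k \<in> {..<d}. lift_from i k < i + a}"
        by (intro image_eqI[of _ _ "if x < d then x else x - d"]) auto
    qed (use i in \<open>auto simp: lift_from_def split: if_splits\<close>)
  qed
  finally have c: "card {j \<in> {..<d}. lift_from i (p j) < i + a} = a" by simp
  have "{j \<in> {..<d}. lift_from i (p j) < i + a} = ?B \<union> crossing i"
  proof (rule Set.set_eqI)
    fix j
    show "j \<in> {j \<in> {..<d}. lift_from i (p j) < i + a} \<longleftrightarrow> j \<in> ?B \<union> crossing i"
    proof (cases "j < d")
      case True
      have "lift_from i j < i + d" using True i by (auto simp: lift_from_def)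
      moreover have "i \<notin> crossing i" using si a by (auto simp: crossing_def lift_from_def)
      ultimately show ?thesis
        using lift_from_p[OF i True] step_le[OF True] si True
        by (cases "j = i"; cases "j \<in> crossing i") (auto simp: lift_from_def[of i i])
    qed (auto simp: crossing_def)
  qed
  moreover have "?B \<inter> crossing i = {}" using a by (auto simp: crossing_def)
  moreover have "finite ?B" "finite (crossing i)" by (auto simp: crossing_def)
  ultimately show ?thesis using c by (simp add: card_Un_disjoint)
qed

text \<open>
  Lift \<open>p\<close> to \<open>i \<mapsto> i + s i\<close> on the integers. Reduction modulo \<open>d\<close> changes the parity of
  the number of inversions by the number \<open>w (d - w)\<close> of pairs of which exactly one point wraps around.
  In the lift only steps of length \<open>a\<close> overtake other points, and each of them overtakes \<open>a - w\<close>.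
\<close>

lemma sign_eq:
  assumes w: "d * w = (\<Sum>j<d. s j)"
  shows "sign p = (-1) ^ (card {i. i < d \<and> s i = a} * (a - w) + w * (d - w))"
proof -
  define q where "q = (\<lambda>i. i + s i)"
  let ?W = "crossing 0" and ?S = "{i. i < d \<and> s i = a}"
  let ?P = "{(i, j). i < j \<and> j < d}"
  let ?X = "{x \<in> ?P. case x of (i, j) \<Rightarrow> (i \<in> ?W) \<noteq> (j \<in> ?W)}"
  \<comment> \<open>\<open>?A\<close> and \<open>?B\<close> are the overtakings in the lift:
    \<open>i\<close> passes \<open>j\<close>, or \<open>j\<close> passes the copy of
    \<open>i\<close> one period later.\<close>
  let ?A = "{x \<in> ?P. case x of (i, j) \<Rightarrow> q j < q i}"
  let ?B = "{x \<in> ?P. case x of (i, j) \<Rightarrow> q i + d < q j}"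
  have d: "0 < d" using a by simp
  have W: "?W = {j. j < d \<and> d \<le> q j}" by (auto simp: crossing_def lift_from_def q_def)
  have crossing_w: "card (crossing i) = w" if "i < d" for i
    using card_crossing[OF that] w d by (metis mult_left_cancel less_numeral_extra(3))
  \<comment> \<open>\<open>p\<close> differs from \<open>q\<close> by \<open>d\<close> on
    \<open>?W\<close> only, so pairs with both or no points in \<open>?W\<close> are inverted alike.
    If only \<open>i\<close> wraps, \<open>q\<close> inverts the pair and \<open>p\<close> does not;
    if only \<open>j\<close> wraps, \<open>p\<close> inverts it unless \<open>j\<close> passes the
    later copy of \<open>i\<close>.\<close>
  have split: "(if p j < p i then -1 else 1 :: int) =
      (if (i \<in> ?W) \<noteq> (j \<in> ?W) then -1 else 1) * (if q j < q i then -1 else 1) *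
      (if q i + d < q j then -1 else 1)" if "i < j" "j < d" for i j
  proof -
    have i: "i < d" using that by simp
    have "p i \<noteq> p j" using permutes_inj[OF p] that by (auto dest: injD)
    then show ?thesis
      using p_cases[OF i] p_cases[OF that(2)] step_le[OF i] step_le[OF that(2)] that i a
      unfolding W by (cases "q i < d"; cases "q j < d") (simp_all add: q_def, arith+)
  qed
  have "sign p = (\<Prod>(i, j)\<in>?P. (if (i \<in> ?W) \<noteq> (j \<in> ?W) then -1 else 1) *
      (if q j < q i then -1 else 1) * (if q i + d < q j then -1 else 1))"
    unfolding sign_eq_inversion_sign[OF p] inversion_sign_def
    by (rule prod.cong[OF refl], clarify) (rule split)
  also have "\<dots> = (-1) ^ card ?X * (-1) ^ card ?A * (-1) ^ card ?B"
    unfolding prod_minus_one_if[OF finite_index_pairs, symmetric]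
    by (simp add: prod.distrib case_prod_unfold)
  also have "\<dots> = (-1) ^ (card ?A + card ?B + card ?X)"
    by (simp add: power_add)
  also have "card ?X = w * (d - w)"
  proof -
    have "bij_betw (\<lambda>(i, j). (min i j, max i j)) (?W \<times> ({..<d} - ?W)) ?X"
    proof (rule bij_betwI')
      fix x y assume "x \<in> ?W \<times> ({..<d} - ?W)" "y \<in> ?W \<times> ({..<d} - ?W)"
      then show "((case x of (i, j) \<Rightarrow> (min i j, max i j)) = (case y of (i, j) \<Rightarrow> (min i j, max i j))) = (x = y)"
        by (cases x; cases y) (auto simp: min_def max_def split: if_splits)
    next
      fix x assume "x \<in> ?W \<times> ({..<d} - ?W)"
      then show "(case x of (i, j) \<Rightarrow> (min i j, max i j)) \<in> ?X"
        unfolding W by (cases x) (auto simp: min_def max_def not_le le_less)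
    next
      fix y assume y: "y \<in> ?X"
      obtain i j where ij: "y = (i, j)" by (cases y)
      show "\<exists>x\<in>?W \<times> ({..<d} - ?W). y = (case x of (i, j) \<Rightarrow> (min i j, max i j))"
        using y unfolding ij
        by (intro bexI[of _ "if i \<in> ?W then (i, j) else (j, i)"]) auto
    qed
    then have "card ?X = card (?W \<times> ({..<d} - ?W))" by (simp add: bij_betw_same_card)
    also have "\<dots> = w * (d - w)"
    proof -
      have "?W \<subseteq> {..<d}" by (auto simp: crossing_def)
      then show ?thesis using crossing_w[OF d] by (simp add: card_Diff_subset finite_subset)
    qed
    finally show ?thesis .
  qed
  also have "card ?A + card ?B = card ?S * (a - w)"
  proof -
    let ?O = "\<lambda>i. {j. j < d \<and> j \<noteq> i \<and> lift_from i j + s j < i + a}"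
    have fin: "finite ?P" by (rule finite_index_pairs)
    have "card (Sigma ?S ?O) = (\<Sum>i\<in>?S. card (?O i))" by simp
    also have "\<dots> = (\<Sum>i\<in>?S. a - w)"
      using card_overtaken crossing_w by (intro sum.cong) fastforce+
    finally have 1: "card (Sigma ?S ?O) = card ?S * (a - w)" by simp
    \<comment> \<open>Overtakings are sorted by the overtaking point \<open>i\<close>: a point
      \<open>j > i\<close> gives a pair of \<open>?A\<close>, while \<open>j < i\<close> is met as
      \<open>j + d\<close> and gives the pair \<open>(j, i)\<close> of \<open>?B\<close>.\<close>
    have "Sigma ?S ?O = ?A \<union> prod.swap ` ?B"
    proof (intro equalityI subsetI)
      fix x assume "x \<in> Sigma ?S ?O"
      then obtain i j where ij: "x = (i, j)" "i < d" "s i = a" "j < d" "j \<noteq> i"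
        "lift_from i j + s j < i + a" by auto
      show "x \<in> ?A \<union> prod.swap ` ?B"
      proof (cases "i < j")
        case True
        then show ?thesis using ij by (auto simp: q_def lift_from_def)
      next
        case False
        then have "(j, i) \<in> ?B" using ij by (auto simp: q_def lift_from_def)
        then show ?thesis using ij by force
      qed
    next
      fix x assume "x \<in> ?A \<union> prod.swap ` ?B"
      then obtain i j where ij: "x = (i, j)" "i < d" "j < d"
        and *: "i < j \<and> q j < q i \<or> j < i \<and> q j + d < q i" by auto
      \<comment> \<open>Passing another point takes a step longer than 1.\<close>
      have "s i = a" using * steps[OF ij(2)] ij by (auto simp: q_def)
      then show "x \<in> Sigma ?S ?O" using ij * by (auto simp: q_def lift_from_def)
    qed
    moreover have "?A \<inter> prod.swap ` ?B = {}" by auto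
    moreover have "card (prod.swap ` ?B) = card ?B" by (intro card_image) auto
    ultimately have "card (Sigma ?S ?O) = card ?A + card ?B"
      using fin by (simp add: card_Un_disjoint)
    with 1 show ?thesis by simp
  qed
  finally show ?thesis .
qed

end

section \<open>Floor sums, and a permutation with prescribed numbers of steps\<close>

lemma sum_shifted_div:
  fixes d m :: int
  assumes "0 < d"
  shows "(\<Sum>i<nat d. ((int i - int k) * m) div d) = (\<Sum>i<nat d. (int i * m) div d) - int k * m"
proof (induction k)
  case (Suc k)
  \<comment> \<open>Sliding the window by one place loses its last term and gains the one
    \<open>d\<close> places earlier; for window length \<open>d\<close> these differ by exactly
    \<open>m\<close>.\<close>
  have "(\<Sum>i<n. ((int i - int k) * m) div d - ((int i - int (Suc k)) * m) div d)
      = ((int n - int (Suc k)) * m) div d - ((- int (Suc k)) * m) div d" for n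
    by (induction n) (auto simp: algebra_simps)
  from this[of "nat d"] have "(\<Sum>i<nat d. ((int i - int k) * m) div d) - (\<Sum>i<nat d. ((int i - int (Suc k)) * m) div d)
      = ((d - int (Suc k)) * m) div d - ((- int (Suc k)) * m) div d"
    using assms by (simp add: sum_subtractf)
  also have "((d - int (Suc k)) * m) div d = (m * d + (- int (Suc k)) * m) div d"
    by (simp add: algebra_simps)
  also have "\<dots> = m + ((- int (Suc k)) * m) div d"
    using assms by (subst div_mult_self3) auto
  finally show ?case using Suc by (simp add: algebra_simps)
qed simp

lemma div_add_eq_if:
  fixes n x d :: int
  assumes "0 < d" "0 \<le> x" "x \<le> d"
  shows "(n + x) div d = n div d + (if d - x \<le> n mod d then 1 else 0)"
proof -
  have "0 \<le> n mod d" "n mod d < d" using assms by auto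
  have "(n + x) div d = (n mod d + x + n div d * d) div d" by (simp add: algebra_simps)
  also have "\<dots> = n div d + (n mod d + x) div d" using assms by (subst div_mult_self1) auto
  also have "(n mod d + x) div d = (if d - x \<le> n mod d then 1 else 0)"
    using assms \<open>0 \<le> n mod d\<close> \<open>n mod d < d\<close>
    by (simp add: div_pos_pos_trivial div_pos_geq)
  finally show ?thesis .
qed

text \<open>
  The indicator of \<open>d - x \<le> i m mod d\<close> is a difference of two floors, and as \<open>x\<close> is a
  multiple of \<open>m\<close> modulo \<open>d\<close>, the floors telescope.
\<close>

lemma card_multiples_mod_ge:
  fixes d m x k r :: nat
  assumes d: "0 < d" and x: "x \<le> d" and eq: "x + k * m = r * d"
  shows "card {i. i < d \<and> d - x \<le> (i * m) mod d} = x"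
proof -
  have "int (card {i. i < d \<and> d - x \<le> (i * m) mod d})
      = (\<Sum>i<d. if d - x \<le> (i * m) mod d then 1 else 0)"
    by (simp add: sum.If_cases Int_def)
  also have "\<dots> = (\<Sum>i<d. int r + ((int i - int k) * int m) div int d - (int i * int m) div int d)"
  proof (rule sum.cong[OF refl])
    fix i
    have "(int i * int m + int x) = (int i - int k) * int m + int r * int d"
      using arg_cong[OF eq, of int] by (simp add: algebra_simps)
    then have "int r + ((int i - int k) * int m) div int d = (int i * int m + int x) div int d"
      using d by simp
    also have "\<dots> = (int i * int m) div int d + (if int d - int x \<le> (int i * int m) mod int d then 1 else 0)"
      using d x by (intro div_add_eq_if) auto
    also have "int d - int x \<le> (int i * int m) mod int d \<longleftrightarrow> d - x \<le> (i * m) mod d"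
      using x by (simp flip: of_nat_mult of_nat_mod of_nat_diff)
    finally show "(if d - x \<le> (i * m) mod d then 1 else 0)
        = int r + ((int i - int k) * int m) div int d - (int i * int m) div int d" by simp
  qed
  also have "\<dots> = int r * int d - int k * int m"
    using sum_shifted_div[of "int d" k "int m"] d by (simp add: sum.distrib sum_subtractf)
  also have "\<dots> = int x" using arg_cong[OF eq, of int] by (simp add: algebra_simps)
  finally show ?thesis by simp
qed

text \<open>
  The step at \<open>i\<close> depends only on \<open>t = i c mod d\<close>: it is an exchange of three intervals of
  residues, with \<open>[0, c)\<close> moved back by \<open>b\<close>, \<open>[c, d - b)\<close> fixed and \<open>[d - b, d)\<close> moved
  forward by \<open>c\<close>.
\<close>

lemma three_step_permutation_exists:
  assumes a: "2 \<le> a" "a < d" and bc: "b + c \<le> d" and dvd: "d dvd b + a * c"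
  obtains s p where "three_step_permutation d a s p"
    "card {i. i < d \<and> s i = 1} = b" "card {i. i < d \<and> s i = a} = c"
proof -
  define t where "t = (\<lambda>i. (i * c) mod d)"
  define s where "s = (\<lambda>i. if t i < c then a else if d - b \<le> t i then 1 else 0)"
  define p where "p = (\<lambda>i. if i < d then (i + s i) mod d else i)"
  \<comment> \<open>The inverse of the exchange: a step 1 adds \<open>c\<close> to \<open>t\<close>,
    and a step \<open>a\<close> subtracts \<open>b\<close> modulo \<open>d\<close> because
    \<open>a c\<close> is congruent to \<open>-b\<close>. As \<open>b + c \<le> d\<close>, the three
    image ranges are disjoint, so the step can be read off at its target.\<close>
  define step_into where "step_into = (\<lambda>v. if v + b < c \<or> d - b \<le> v \<and> v < d - b + c then a
    else if c \<le> v \<and> v < d - b then 0 else 1)"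
  have d: "0 < d" using a by simp
  obtain r where r: "b + a * c = r * d" using dvd by (metis dvdE mult.commute)
  have tp: "step_into (t (p i)) = s i" if "i < d" for i
  proof -
    let ?v = "t (p i)"
    have v: "?v < d" and t: "t i < d" using d by (auto simp: t_def)
    have v_eq: "?v = (t i + s i * c) mod d"
      using that unfolding t_def p_def by (simp add: mod_simps algebra_simps)
    consider "t i < c" | "c \<le> t i" "d - b \<le> t i" | "c \<le> t i" "t i < d - b" by linarith
    then show ?thesis
    proof cases
      case 1
      have "(?v + b) mod d = (t i + r * d) mod d"
        using 1 unfolding v_eq r[symmetric] s_def by (simp add: mod_simps algebra_simps)
      then have "(?v + b) mod d = t i" using t by simp
      then have "?v + b = t i \<or> ?v + b = t i + d"
        using v bc by (cases "?v + b < d") (simp_all add: le_mod_geq, arith)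
      then show ?thesis using 1 bc by (auto simp: step_into_def s_def)
    next
      case 2
      then have "s i = 1" by (auto simp: s_def)
      then have "?v = (if t i + c < d then t i + c else t i + c - d)"
        using t bc v_eq by (simp add: le_mod_geq)
      then show ?thesis using 2 bc \<open>s i = 1\<close> t a by (auto simp: step_into_def)
    next
      case 3
      then have "s i = 0" by (auto simp: s_def)
      then have "?v = t i" using t v_eq by simp
      then show ?thesis using 3 bc \<open>s i = 0\<close> by (auto simp: step_into_def)
    qed
  qed
  have "inj_on p {..<d}"
  proof (rule inj_onI)
    fix i j assume ij: "i \<in> {..<d}" "j \<in> {..<d}" "p i = p j"
    then have "s i = s j" using tp by (metis lessThan_iff)
    then have "(i + s i) mod d = (j + s i) mod d" using ij by (simp add: p_def)
    moreover have "s j < d" using a by (simp add: s_def)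
    ultimately show "i = j"
      using ij \<open>s i = s j\<close>
      by (cases "i + s j < d"; cases "j + s j < d") (simp_all add: le_mod_geq)
  qed
  moreover have "p ` {..<d} \<subseteq> {..<d}" using d by (auto simp: p_def)
  ultimately have "bij_betw p {..<d} {..<d}"
    unfolding bij_betw_def by (simp add: endo_inj_surj)
  then have "p permutes {..<d}" by (rule bij_imp_permutes) (auto simp: p_def)
  then have "three_step_permutation d a s p"
    using a by unfold_locales (auto simp: s_def p_def)
  moreover have "card {i. i < d \<and> s i = 1} = b"
  proof -
    \<comment> \<open>\<open>i c mod d\<close> meets only multiples of \<open>gcd(c, d)\<close> and
      may repeat values, yet the count is exactly \<open>b\<close>, because \<open>b\<close> is
      itself a multiple of \<open>c\<close> modulo \<open>d\<close>.\<close>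
    have "{i. i < d \<and> s i = 1} = {i. i < d \<and> d - b \<le> (i * c) mod d}"
      using a bc by (auto simp: s_def t_def)
    then show ?thesis using card_multiples_mod_ge[of d b a c r] d bc r by simp
  qed
  moreover have "card {i. i < d \<and> s i = a} = c"
  proof -
    have "{i. i < d \<and> s i = a} = {..<d} - {i. i < d \<and> d - (d - c) \<le> (i * c) mod d}"
      using a bc by (auto simp: s_def t_def)
    \<comment> \<open>Here the required congruence is simply
      \<open>(d - c) + 1 * c = 1 * d\<close>.\<close>
    also have "card \<dots> = d - (d - c)"
      using card_multiples_mod_ge[of d "d - c" 1 c 1] d bc by (subst card_Diff_subset) auto
    finally show ?thesis using bc by simp
  qed
  ultimately show ?thesis by (rule that)
qed

section \<open>The coefficients of the circulant determinant\<close>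

lemma primitive_root_power_eq_1_iff:
  fixes e :: "'k::field"
  assumes e: "primitive_root_of_unity d e"
  shows "e ^ n = 1 \<longleftrightarrow> d dvd n"
proof -
  have d: "0 < d" and ed: "e ^ d = 1" using e by (auto simp: primitive_root_of_unity_def)
  have "e ^ n = e ^ (d * (n div d) + n mod d)" by simp
  also have "\<dots> = e ^ (n mod d)" unfolding power_add power_mult ed by simp
  finally have "e ^ n = e ^ (n mod d)" .
  moreover have "n mod d < d" using d by simp
  ultimately show ?thesis
    using e unfolding primitive_root_of_unity_def by (metis mod_eq_0_iff_dvd neq0_conv power_0)
qed

lemma primitive_root_nonzero: "primitive_root_of_unity d e \<Longrightarrow> e \<noteq> (0 :: 'k::field)"
  unfolding primitive_root_of_unity_def by (auto simp: power_0_left)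

lemma primitive_root_power_inj:
  fixes e :: "'k::field"
  assumes e: "primitive_root_of_unity d e" and "i < d" "j < d" "e ^ i = e ^ j"
  shows "i = j"
proof -
  have *: "i = j" if "i \<le> j" "j < d" "e ^ i = e ^ j" for i j
  proof -
    have "e ^ j = e ^ i * e ^ (j - i)" using that by (metis le_add_diff_inverse power_add)
    then have "e ^ (j - i) = 1" using that primitive_root_nonzero[OF e] by simp
    then have "d dvd j - i" by (simp add: primitive_root_power_eq_1_iff[OF e])
    then show ?thesis using that by (auto dest: dvd_imp_le)
  qed
  show ?thesis using *[of i j] *[of j i] assms by (cases "i \<le> j") auto
qed

section \<open>Eigenvectors of the circulant\<close>

definition fourier_mat :: "nat \<Rightarrow> 'k::comm_ring_1 \<Rightarrow> 'k mat" where
  "fourier_mat d e = mat d d (\<lambda>(k, i). e ^ (i * k))"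

text \<open>By orthogonality of characters, multiplying by the matrix of inverse powers gives
  \<open>d\<close> times the identity, and \<open>d\<close> is nonzero in characteristic
  zero.\<close>

lemma det_fourier_mat_nonzero:
  fixes e :: "'k::field_char_0"
  assumes e: "primitive_root_of_unity d e"
  shows "det (fourier_mat d e) \<noteq> 0"
proof -
  let ?F = "fourier_mat d e" and ?G = "mat d d (\<lambda>(i, l). inverse e ^ (i * l))"
  have d: "0 < d" and ed: "e ^ d = 1" using e by (auto simp: primitive_root_of_unity_def)
  have e0: "e \<noteq> 0" by (rule primitive_root_nonzero[OF e])
  have "?F * ?G = of_nat d \<cdot>\<^sub>m 1\<^sub>m d"
  proof (rule eq_matI)
    fix k l assume kl: "k < dim_row (of_nat d \<cdot>\<^sub>m 1\<^sub>m d :: 'k mat)" "l < dim_col (of_nat d \<cdot>\<^sub>m 1\<^sub>m d :: 'k mat)"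
    have "(?F * ?G) $$ (k, l) = (\<Sum>i<d. (e ^ k * inverse e ^ l) ^ i)"
      using kl by (simp add: fourier_mat_def scalar_prod_def power_mult_distrib mult.commute
          atLeast0LessThan flip: power_mult)
    also have "\<dots> = (if k = l then of_nat d else 0)"
    proof (cases "k = l")
      case True
      then show ?thesis using e0 by (simp flip: power_mult_distrib)
    next
      case False
      have "e ^ k * inverse e ^ l \<noteq> 1"
      proof
        assume "e ^ k * inverse e ^ l = 1"
        then have "e ^ k = e ^ l" using e0 by (simp add: field_simps power_inverse)
        with primitive_root_power_inj[OF e] kl False show False by simp
      qed
      moreover have "(e ^ k * inverse e ^ l) ^ d = 1"
        using ed by (simp add: power_mult_distrib mult.commute[of _ d] power_mult power_inverse flip: power_mult)
          (simp add: power_mult)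
      ultimately show ?thesis using False by (simp add: sum_gp_strict)
    qed
    finally show "(?F * ?G) $$ (k, l) = (of_nat d \<cdot>\<^sub>m 1\<^sub>m d) $$ (k, l)" using kl by simp
  qed (auto simp: fourier_mat_def)
  then have "det ?F * det ?G = of_nat d ^ d"
    by (subst det_mult[symmetric, of _ d]) (auto simp: fourier_mat_def)
  then show ?thesis using d by auto
qed

text \<open>The orbit product of \<open>x + y + z\<close> at \<open>z = 1\<close>, with
  \<open>x\<close> as the outer and \<open>y\<close> as the inner variable.\<close>

definition norm_poly :: "nat \<Rightarrow> nat \<Rightarrow> 'k::comm_ring_1 \<Rightarrow> 'k poly poly" where
  "norm_poly d a e = (\<Prod>i<d. [: [:e ^ (a * i), e ^ i:], 1:])"

text \<open>The matrix of \<open>x + y S + S^a\<close> for the cyclic shift \<open>S\<close>. The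
  entries are sums of three terms, so that its product with an eigenvector splits by
  linearity.\<close>

definition circulant_mat :: "nat \<Rightarrow> nat \<Rightarrow> 'k::comm_ring_1 poly poly mat" where
  "circulant_mat d a = mat d d (\<lambda>(j, k).
     (if k = j then [:0, 1:] else 0) + (if k = (j + 1) mod d then [:[:0, 1:]:] else 0) +
     (if k = (j + a) mod d then 1 else 0))"

text \<open>The shift multiplies column \<open>i\<close> of the Fourier matrix by
  \<open>e^i\<close>, so these columns are eigenvectors whose eigenvalues are the factors of
  \<open>norm_poly\<close>. The nonzero Fourier determinant then cancels.\<close>

lemma det_circulant_mat:
  fixes e :: "'k::field_char_0"
  assumes e: "primitive_root_of_unity d e"
  shows "det (circulant_mat d a) = norm_poly d a e"
proof -
  interpret \<kappa>: comm_ring_hom "\<lambda>c::'k. [:[:c:]:]"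
    by unfold_locales (auto simp: one_pCons)
  let ?\<kappa> = "\<lambda>c::'k. [:[:c:]:]"
  define F where "F = map_mat ?\<kappa> (fourier_mat d e)"
  define D where "D = mat d d (\<lambda>(i, j). if i = j then [: [:e ^ (a * i), e ^ i:], 1:] else 0)"
  have d: "0 < d" and ed: "e ^ d = 1" using e by (auto simp: primitive_root_of_unity_def)
  have F: "F \<in> carrier_mat d d" and D: "D \<in> carrier_mat d d"
    and C: "(circulant_mat d a :: 'k poly poly mat) \<in> carrier_mat d d"
    by (auto simp: F_def D_def fourier_mat_def circulant_mat_def)
  have F_index: "F $$ (k, i) = ?\<kappa> (e ^ (i * k))" if "k < d" "i < d" for k i
    using that by (simp add: F_def fourier_mat_def)
  have e_mod: "e ^ (i * (k mod d)) = e ^ (i * k)" for i k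
  proof -
    have "e ^ (i * k) = e ^ (i * (d * (k div d) + k mod d))" by simp
    also have "\<dots> = (e ^ d) ^ (i * (k div d)) * e ^ (i * (k mod d))"
      unfolding distrib_left power_add by (simp add: ac_simps flip: power_mult)
    finally show ?thesis using ed by simp
  qed
  have "circulant_mat d a * F = F * D"
  proof (rule eq_matI)
    fix j i assume ji: "j < dim_row (F * D)" "i < dim_col (F * D)"
    then have j: "j < d" and i: "i < d" using F D by auto
    have "(circulant_mat d a * F) $$ (j, i) = (\<Sum>k<d. circulant_mat d a $$ (j, k) * F $$ (k, i))"
      using i j carrier_matD[OF C] carrier_matD[OF F] by (simp add: scalar_prod_def atLeast0LessThan)
    also have "\<dots> = (\<Sum>k<d. (if k = j then [:0, 1:] * F $$ (k, i) else 0)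
        + (if k = (j + 1) mod d then [:[:0, 1:]:] * F $$ (k, i) else 0)
        + (if k = (j + a) mod d then F $$ (k, i) else 0))"
      using j by (intro sum.cong) (auto simp: circulant_mat_def distrib_right)
    also have "\<dots> = [:0, 1:] * F $$ (j, i) + [:[:0, 1:]:] * F $$ ((j + 1) mod d, i)
        + F $$ ((j + a) mod d, i)"
      using j d by (simp add: sum.distrib)
    also have "\<dots> = F $$ (j, i) * [: [:e ^ (a * i), e ^ i:], 1:]"
      using i j d by (simp add: F_index e_mod power_add algebra_simps)
    also have "\<dots> = (\<Sum>k<d. F $$ (j, k) * D $$ (k, i))"
    proof -
      have "(\<Sum>k<d. F $$ (j, k) * D $$ (k, i)) = (\<Sum>k<d. if k = i then F $$ (j, k) * [: [:e ^ (a * k), e ^ k:], 1:] else 0)"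
        using i by (intro sum.cong) (auto simp: D_def)
      then show ?thesis using i by simp
    qed
    also have "\<dots> = (F * D) $$ (j, i)"
      using i j carrier_matD[OF D] carrier_matD[OF F] by (simp add: scalar_prod_def atLeast0LessThan)
    finally show "(circulant_mat d a * F) $$ (j, i) = (F * D) $$ (j, i)" .
  qed (use F D C in auto)
  then have "det (circulant_mat d a) * det F = det F * det D"
    using det_mult[OF C F] det_mult[OF F D] by metis
  moreover have "det F \<noteq> 0"
    using det_fourier_mat_nonzero[OF e] unfolding F_def by simp
  ultimately have "det (circulant_mat d a) = det D" by (metis mult.commute mult_left_cancel)
  also have "\<dots> = prod_list (diag_mat D)"
    by (rule det_upper_triangular[OF _ D]) (auto simp: D_def)
  also have "\<dots> = norm_poly d a e"
    unfolding prod_list_diag_prod using D by (simp add: D_def norm_poly_def atLeast0LessThan)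
  finally show ?thesis .
qed

section \<open>Permutation expansion of the circulant determinant\<close>

lemma coeff_monom_product:
  "coeff (coeff ([:0, 1:] ^ i * [:[:0, 1:]:] ^ j) m) n = (if i = m \<and> j = n then 1 else (0 :: 'k::comm_ring_1))"
proof -
  have "[:0, 1:] ^ i = (monom 1 i :: 'k poly poly)"
    by (simp add: monom_altdef)
  moreover have "[:[:0, 1:]:] ^ j = ([:monom 1 j:] :: 'k poly poly)"
    by (induction j) (simp_all add: monom_altdef one_pCons)
  ultimately show ?thesis by (simp add: coeff_monom_mult)
qed

lemma add_mod_cancel_less:
  fixes j k l d :: nat
  assumes "j < d" "k < d" "l < d"
  shows "(j + k) mod d = (j + l) mod d \<longleftrightarrow> k = l"
proof -
  have "(j + i) mod d = (if j + i < d then j + i else j + i - d)" if "i < d" for i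
    using that assms by (simp add: le_mod_geq)
  from this[OF assms(2)] this[OF assms(3)] show ?thesis
    using assms by (cases "j + k < d"; cases "j + l < d") auto
qed

lemma step_residues_distinct:
  fixes j a d :: nat
  assumes "2 \<le> a" "a < d" "j < d"
  shows "(j + 1) mod d \<noteq> j" "(j + a) mod d \<noteq> j" "(j + a) mod d \<noteq> (j + 1) mod d"
  using add_mod_cancel_less[of j d 1 0] add_mod_cancel_less[of j d a 0]
    add_mod_cancel_less[of j d a 1] assms by auto

lemma circulant_mat_index:
  assumes "2 \<le> a" "a < d" "j < d" "k < d"
  shows "circulant_mat d a $$ (j, k) = (if k = j then [:0, 1:] else if k = (j + 1) mod d then [:[:0, 1:]:]
    else if k = (j + a) mod d then 1 else 0)"
  using assms step_residues_distinct[of a d j] by (auto simp: circulant_mat_def)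

text \<open>For \<open>2 \<le> a < d\<close>, the permutations contributing to the coefficient of
  \<open>x^m y^n\<close>; their other \<open>d - m - n\<close> steps have length
  \<open>a\<close>.\<close>

definition circulant_perms :: "nat \<Rightarrow> nat \<Rightarrow> nat \<Rightarrow> nat \<Rightarrow> (nat \<Rightarrow> nat) set" where
  "circulant_perms d a m n = {p. p permutes {..<d} \<and>
     (\<forall>j<d. p j = j \<or> p j = (j + 1) mod d \<or> p j = (j + a) mod d) \<and>
     card {j. j < d \<and> p j = j} = m \<and> card {j. j < d \<and> p j = (j + 1) mod d} = n}"

lemma finite_circulant_perms: "finite (circulant_perms d a m n)"
  by (rule finite_subset[OF _ finite_permutations[of "{..<d}"]]) (auto simp: circulant_perms_def)

lemma circulant_perm_summand:
  assumes a: "2 \<le> a" "a < d" and p: "p permutes {..<d}"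
  shows "coeff (coeff (\<Prod>j<d. circulant_mat d a $$ (j, p j)) m) n
    = (if p \<in> circulant_perms d a m n then 1 else (0 :: 'k::comm_ring_1))"
proof (cases "\<forall>j<d. p j = j \<or> p j = (j + 1) mod d \<or> p j = (j + a) mod d")
  case True
  have pd: "p j < d" if "j < d" for j using permutes_in_image[OF p, of j] that by simp
  have ne: "(j + 1) mod d \<noteq> j" if "j < d" for j
    by (rule step_residues_distinct[OF a that])
  have "(\<Prod>j<d. circulant_mat d a $$ (j, p j) :: 'k poly poly)
      = (\<Prod>j<d. (if p j = j then [:0, 1:] else 1) * (if p j = (j + 1) mod d then [:[:0, 1:]:] else 1))"
  proof (rule prod.cong[OF refl])
    fix j assume "j \<in> {..<d}"
    then have j: "j < d" by simp
    show "circulant_mat d a $$ (j, p j) = (if p j = j then [:0, 1:] else 1) *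
        (if p j = (j + 1) mod d then [:[:0, 1:]:] else (1 :: 'k poly poly))"
      unfolding circulant_mat_index[OF a j pd[OF j]]
      using True j ne[OF j] by (cases "p j = j"; cases "p j = (j + 1) mod d") auto
  qed
  also have "\<dots> = [:0, 1:] ^ card {j. j < d \<and> p j = j} * [:[:0, 1:]:] ^ card {j. j < d \<and> p j = (j + 1) mod d}"
    by (simp add: prod.distrib prod.If_cases Int_def)
  finally show ?thesis
    using True p by (auto simp: coeff_monom_product circulant_perms_def)
next
  case False
  then obtain j where j: "j < d" "p j \<noteq> j" "p j \<noteq> (j + 1) mod d" "p j \<noteq> (j + a) mod d"
    by blast
  then have "p j < d" using permutes_in_image[OF p, of j] by simp
  with j have "circulant_mat d a $$ (j, p j) = (0 :: 'k poly poly)"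
    by (simp only: circulant_mat_index[OF a] if_False)
  with j have "(\<Prod>j<d. circulant_mat d a $$ (j, p j)) = (0 :: 'k poly poly)"
    by (intro prod_zero) auto
  moreover have "p \<notin> circulant_perms d a m n" using False by (auto simp: circulant_perms_def)
  ultimately show ?thesis by simp
qed

text \<open>The numbers of steps of each length fix the total \<open>n + a c = d w\<close>, hence
  the winding number and with it the sign, whichever permutation is taken.\<close>

lemma sign_circulant_perm:
  assumes a: "2 \<le> a" "a < d" and perm: "p \<in> circulant_perms d a m n"
    and c: "m + n + c = d" and w: "n + a * c = d * w"
  shows "sign p = (-1) ^ (c * (a - w) + w * (d - w))"
proof -
  define s where "s = (\<lambda>j. if p j = j then 0 else if p j = (j + 1) mod d then 1 else a)"
  interpret three_step_permutation d a s p
    using a perm by unfold_locales (auto simp: circulant_perms_def s_def)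
  let ?A = "{j. j < d \<and> p j = j}" and ?B = "{j. j < d \<and> p j = (j + 1) mod d}"
    and ?C = "{j. j < d \<and> s j = a}"
  have ne: "(j + 1) mod d \<noteq> j" if "j < d" for j
    by (rule step_residues_distinct[OF a that])
  have AB: "?A \<inter> ?B = {}" using ne by auto
  have card_AB: "card ?A = m" "card ?B = n" using perm by (simp_all add: circulant_perms_def)
  have "?C = {..<d} - (?A \<union> ?B)" using a by (auto simp: s_def)
  then have "card ?C = d - (card ?A + card ?B)"
    using AB by (simp add: card_Diff_subset card_Un_disjoint finite_subset[of _ "{..<d}"] subset_iff)
  then have C: "card ?C = c" unfolding card_AB using c by simp
  have "(\<Sum>j<d. s j) = (\<Sum>j<d. (if p j = (j + 1) mod d then 1 else 0) + (if s j = a then a else 0))"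
    using a ne by (intro sum.cong) (auto simp: s_def)
  also have "\<dots> = card ?B + card ?C * a"
    by (simp add: sum.distrib sum.If_cases Int_def)
  also have "\<dots> = d * w" unfolding card_AB C using w by (simp add: mult.commute)
  finally show ?thesis using sign_eq[of w] C by simp
qed

lemma circulant_perms_nonempty:
  assumes a: "2 \<le> a" "a < d" and c: "m + n + c = d" and dvd: "d dvd n + a * c"
  shows "circulant_perms d a m n \<noteq> {}"
proof -
  have bc: "n + c \<le> d" using c by simp
  obtain s p where "three_step_permutation d a s p" and n: "card {i. i < d \<and> s i = 1} = n"
    and c': "card {i. i < d \<and> s i = a} = c"
    by (rule three_step_permutation_exists[OF a bc dvd])
  then interpret three_step_permutation d a s p by simp
  have ne: "(j + 1) mod d \<noteq> j" "(j + a) mod d \<noteq> j" "(j + a) mod d \<noteq> (j + 1) mod d" if "j < d" for j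
    by (rule step_residues_distinct[OF a that])+
  have step_iff: "(p j = (j + 1) mod d \<longleftrightarrow> s j = 1) \<and> (p j = j \<longleftrightarrow> s j \<noteq> 1 \<and> s j \<noteq> a) \<and>
    (p j = j \<or> p j = (j + 1) mod d \<or> p j = (j + a) mod d)" if j: "j < d" for j
  proof -
    consider "s j = 0" | "s j = 1" | "s j = a" using steps[OF j] by (elim insertE emptyE)
    then show ?thesis
    proof cases
      case 1
      then have "p j = j" using p_eq[OF j] j by simp
      then show ?thesis using 1 ne[OF j] a by (metis not_numeral_le_zero zero_neq_one)
    next
      case 2
      then have "p j = (j + 1) mod d" using p_eq[OF j] by (simp only:)
      then show ?thesis using 2 ne[OF j] by metis
    next
      case 3
      then have "p j = (j + a) mod d" using p_eq[OF j] by (simp only:)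
      then show ?thesis using 3 ne[OF j] a by (metis Suc_1 not_less_eq_eq One_nat_def le_refl)
    qed
  qed
  have B: "{j. j < d \<and> p j = (j + 1) mod d} = {i. i < d \<and> s i = 1}"
    using step_iff by blast
  have "{j. j < d \<and> p j = j} = {..<d} - ({i. i < d \<and> s i = 1} \<union> {i. i < d \<and> s i = a})"
    using step_iff by blast
  also have "card \<dots> = d - (n + c)"
  proof -
    have "{i. i < d \<and> s i = 1} \<inter> {i. i < d \<and> s i = a} = {}" using a by auto
    then have "card ({i. i < d \<and> s i = 1} \<union> {i. i < d \<and> s i = a}) = n + c"
      using n c' by (simp add: card_Un_disjoint)
    then show ?thesis by (subst card_Diff_subset) auto
  qed
  also have "\<dots> = m" using c by simp
  finally have A: "card {j. j < d \<and> p j = j} = m" .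
  have "p \<in> circulant_perms d a m n"
    unfolding circulant_perms_def mem_Collect_eq
  proof (intro conjI)
    show "\<forall>j<d. p j = j \<or> p j = (j + 1) mod d \<or> p j = (j + a) mod d" using step_iff by blast
    show "card {j. j < d \<and> p j = (j + 1) mod d} = n" unfolding B by (rule n)
  qed (rule p A)+
  then show ?thesis by blast
qed

text \<open>No two contributions cancel: the coefficient is plus or minus a positive count, and
  characteristic zero keeps it nonzero.\<close>

theorem coeff_norm_poly_nonzero:
  fixes e :: "'k::field_char_0"
  assumes e: "primitive_root_of_unity d e" and a: "2 \<le> a" "a < d"
    and c: "m + n + c = d" and dvd: "d dvd n + a * c"
  shows "coeff (coeff (norm_poly d a e) m) n \<noteq> 0"
proof -
  obtain w where w: "n + a * c = d * w" using dvd by auto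
  let ?G = "circulant_perms d a m n" and ?\<sigma> = "(-1) ^ (c * (a - w) + w * (d - w)) :: 'k"
  have C: "(circulant_mat d a :: 'k poly poly mat) \<in> carrier_mat d d"
    by (auto simp: circulant_mat_def)
  have coeff_of_int: "coeff (of_int z * q) i = of_int z * coeff q i" for z i and q :: "'b::comm_ring_1 poly"
    by (simp add: of_int_poly)
  have "coeff (coeff (norm_poly d a e) m) n
      = (\<Sum>p | p permutes {..<d}. of_int (sign p) * coeff (coeff (\<Prod>j<d. circulant_mat d a $$ (j, p j)) m) n)"
    unfolding det_circulant_mat[OF e, of a, symmetric] det_def'[OF C]
    by (simp add: coeff_sum coeff_of_int atLeast0LessThan)
  also have "\<dots> = (\<Sum>p | p permutes {..<d}. if p \<in> ?G then ?\<sigma> else 0)"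
  proof (rule sum.cong[OF refl])
    fix p assume "p \<in> {p. p permutes {..<d}}"
    then show "of_int (sign p) * coeff (coeff (\<Prod>j<d. circulant_mat d a $$ (j, p j)) m) n
        = (if p \<in> ?G then ?\<sigma> else 0)"
      using sign_circulant_perm[OF a _ c w, of p]
      by (cases "p \<in> ?G") (simp_all add: circulant_perm_summand[OF a])
  qed
  also have "\<dots> = (\<Sum>p\<in>?G. ?\<sigma>)"
    by (rule sum.mono_neutral_cong_right[OF finite_permutations])
      (auto simp: circulant_perms_def)
  also have "\<dots> = of_nat (card ?G) * ?\<sigma>" by simp
  also have "\<dots> \<noteq> 0"
    using circulant_perms_nonempty[OF a c dvd] finite_circulant_perms[of d a m n] by simp
  finally show ?thesis .
qed

section \<open>Polynomials in three variables\<close>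

lemma poly_mapping_eq_sum_single:
  "p = (\<Sum>m\<in>Poly_Mapping.keys p. Poly_Mapping.single m (Poly_Mapping.lookup p m))"
  by (rule poly_mapping_eqI) (simp add: lookup_sum lookup_single when_def in_keys_iff)

text \<open>Substitution of variables and dehomogenisation are both instances, so multiplicativity
  is proved once for both.\<close>

definition pm_eval :: "('k::zero \<Rightarrow> 'b::comm_ring_1) \<Rightarrow> ('m \<Rightarrow> 'b) \<Rightarrow> ('m \<Rightarrow>\<^sub>0 'k) \<Rightarrow> 'b" where
  "pm_eval \<kappa> \<theta> p = (\<Sum>m\<in>Poly_Mapping.keys p. \<kappa> (Poly_Mapping.lookup p m) * \<theta> m)"

lemma comm_ring_hom_pm_eval:
  fixes \<kappa> :: "'k::comm_ring_1 \<Rightarrow> 'b::comm_ring_1" and \<theta> :: "'m::comm_monoid_add \<Rightarrow> 'b"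
  assumes "comm_ring_hom \<kappa>" and \<theta>: "\<theta> 0 = 1" "\<And>m n. \<theta> (m + n) = \<theta> m * \<theta> n"
  shows "comm_ring_hom (pm_eval \<kappa> \<theta>)"
proof -
  interpret \<kappa>: comm_ring_hom \<kappa> by fact
  let ?E = "pm_eval \<kappa> \<theta>"
  have superset: "?E p = (\<Sum>m\<in>A. \<kappa> (Poly_Mapping.lookup p m) * \<theta> m)"
    if "finite A" "Poly_Mapping.keys p \<subseteq> A" for p A
    unfolding pm_eval_def using that by (intro sum.mono_neutral_left) (auto simp: in_keys_iff)
  have add: "?E (p + q) = ?E p + ?E q" for p q
    using keys_add[of p q]
    by (simp add: superset[of "Poly_Mapping.keys p \<union> Poly_Mapping.keys q"]
        lookup_add \<kappa>.hom_add distrib_right sum.distrib)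
  have zero: "?E 0 = 0" by (simp add: pm_eval_def)
  have sum: "?E (\<Sum>x\<in>S. f x) = (\<Sum>x\<in>S. ?E (f x))" for S and f :: "'s \<Rightarrow> _"
    by (induction S rule: infinite_finite_induct) (simp_all add: add zero)
  have single: "?E (Poly_Mapping.single m c) = \<kappa> c * \<theta> m" for m c
    by (simp add: pm_eval_def)
  have mult: "?E (p * q) = ?E p * ?E q" for p q
  proof -
    have "p * q = (\<Sum>m\<in>Poly_Mapping.keys p. \<Sum>n\<in>Poly_Mapping.keys q.
        Poly_Mapping.single (m + n) (Poly_Mapping.lookup p m * Poly_Mapping.lookup q n))"
      by (subst poly_mapping_eq_sum_single[of p], subst poly_mapping_eq_sum_single[of q])
        (simp add: sum_product mult_single)
    then have "?E (p * q) = (\<Sum>m\<in>Poly_Mapping.keys p. \<Sum>n\<in>Poly_Mapping.keys q.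
        (\<kappa> (Poly_Mapping.lookup p m) * \<theta> m) * (\<kappa> (Poly_Mapping.lookup q n) * \<theta> n))"
      by (simp add: sum single \<theta> \<kappa>.hom_mult ac_simps)
    then show ?thesis by (simp add: pm_eval_def sum_product)
  qed
  show ?thesis
    using add mult zero single[of 0 1] \<theta> by unfold_locales simp_all
qed

lemma comm_ring_hom_const: "comm_ring_hom (const :: 'k::comm_ring_1 \<Rightarrow> 'k poly3)"
  by unfold_locales (simp_all add: const_def single_add mult_single)

lemma comm_ring_hom_subst_vars:
  "comm_ring_hom (subst_vars f :: 'k::comm_ring_1 poly3 \<Rightarrow> 'k poly3)"
proof -
  have "subst_vars f = pm_eval const (\<lambda>m. \<Prod>v\<in>UNIV. f v ^ Poly_Mapping.lookup m v)"
    by (simp add: fun_eq_iff subst_vars_def pm_eval_def)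
  then show ?thesis
    by (simp only:) (rule comm_ring_hom_pm_eval[OF comm_ring_hom_const],
        simp_all add: lookup_add power_add prod.distrib)
qed

lemma expo_eqI:
  assumes "Poly_Mapping.lookup m X = Poly_Mapping.lookup n X"
    and "Poly_Mapping.lookup m Y = Poly_Mapping.lookup n Y"
    and "Poly_Mapping.lookup m Z = Poly_Mapping.lookup n Z"
  shows "m = (n :: expo)"
proof (rule poly_mapping_eqI)
  show "Poly_Mapping.lookup m v = Poly_Mapping.lookup n v" for v
    using assms by (cases v) auto
qed

lemma expo_deg_eq:
  "expo_deg m = Poly_Mapping.lookup m X + Poly_Mapping.lookup m Y + Poly_Mapping.lookup m Z"
  by (simp add: expo_deg_def UNIV_var)

lemma expo_deg_add: "expo_deg (m + n) = expo_deg m + expo_deg n"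
  by (simp add: expo_deg_eq lookup_add)

lemma expo_deg_0_iff: "expo_deg m = 0 \<longleftrightarrow> m = 0"
  by (auto simp: expo_deg_eq intro: expo_eqI)

definition mk_expo :: "nat \<Rightarrow> nat \<Rightarrow> nat \<Rightarrow> expo" where
  "mk_expo i j k = Poly_Mapping.single X i + Poly_Mapping.single Y j + Poly_Mapping.single Z k"

lemma lookup_mk_expo [simp]:
  "Poly_Mapping.lookup (mk_expo i j k) X = i"
  "Poly_Mapping.lookup (mk_expo i j k) Y = j"
  "Poly_Mapping.lookup (mk_expo i j k) Z = k"
  by (simp_all add: mk_expo_def lookup_add lookup_single)

lemma expo_deg_mk_expo [simp]: "expo_deg (mk_expo i j k) = i + j + k"
  by (simp add: expo_deg_eq)

lemma mk_expo_lookup: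
  "mk_expo (Poly_Mapping.lookup m X) (Poly_Mapping.lookup m Y) (Poly_Mapping.lookup m Z) = m"
  by (rule expo_eqI) simp_all

lemma finite_expo_deg: "finite {m. expo_deg m = n}"
proof (rule finite_subset)
  show "{m. expo_deg m = n} \<subseteq> (\<lambda>(i, j, k). mk_expo i j k) ` ({..n} \<times> {..n} \<times> {..n})"
  proof
    fix m assume "m \<in> {m. expo_deg m = n}"
    then show "m \<in> (\<lambda>(i, j, k). mk_expo i j k) ` ({..n} \<times> {..n} \<times> {..n})"
      by (intro image_eqI[of _ _ "(Poly_Mapping.lookup m X, Poly_Mapping.lookup m Y, Poly_Mapping.lookup m Z)"])
        (auto simp: expo_deg_eq mk_expo_lookup)
  qed
qed auto

lemma monomial_add: "monomial (m + n) = monomial m * (monomial n :: 'k::comm_ring_1 poly3)"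
  by (simp add: monomial_def mult_single)

lemma monomial_power: "monomial (Poly_Mapping.single v i) = (variable v ^ i :: 'k::comm_ring_1 poly3)"
proof (induction i)
  case (Suc i)
  have "Poly_Mapping.single v (Suc i) = Poly_Mapping.single v 1 + Poly_Mapping.single v i"
    by (simp flip: single_add)
  then show ?case using Suc by (simp only: monomial_add power_Suc variable_def)
qed (simp add: monomial_def)

lemma keys_monomial [simp]: "Poly_Mapping.keys (monomial m :: 'k::comm_ring_1 poly3) = {m}"
  by (simp add: monomial_def)

lemma inj_monomial: "inj (monomial :: expo \<Rightarrow> 'k::comm_ring_1 poly3)"
  by (rule injI) (metis keys_monomial singleton_inject)

text \<open>The exponent of \<open>e\<close> in the factor by which the matrix scales the monomial;
  \<open>x\<close> is fixed and contributes nothing.\<close>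

definition weight :: "nat \<Rightarrow> expo \<Rightarrow> nat" where
  "weight a m = Poly_Mapping.lookup m Y + a * Poly_Mapping.lookup m Z"

lemma M_act_eq_sum:
  "M_act e a p = (\<Sum>m\<in>Poly_Mapping.keys p. Poly_Mapping.single m (e ^ weight a m * Poly_Mapping.lookup p m))"
proof -
  have "const c * (\<Prod>v\<in>UNIV. (case v of X \<Rightarrow> variable X | Y \<Rightarrow> const e * variable Y
      | Z \<Rightarrow> const (e ^ a) * variable Z) ^ Poly_Mapping.lookup m v)
    = Poly_Mapping.single m (e ^ weight a m * c)" for c :: 'a and m
  proof -
    interpret const: comm_ring_hom "const :: 'a \<Rightarrow> 'a poly3" by (rule comm_ring_hom_const)
    have "(\<Prod>v\<in>UNIV. (case v of X \<Rightarrow> variable X | Y \<Rightarrow> const e * variable Y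
      | Z \<Rightarrow> const (e ^ a) * variable Z) ^ Poly_Mapping.lookup m v)
      = const (e ^ weight a m) * (variable X ^ Poly_Mapping.lookup m X *
          variable Y ^ Poly_Mapping.lookup m Y * variable Z ^ Poly_Mapping.lookup m Z)"
      by (simp add: UNIV_var power_mult_distrib weight_def power_add power_mult
          const.hom_mult const.hom_power ac_simps)
    also have "variable X ^ Poly_Mapping.lookup m X *
          variable Y ^ Poly_Mapping.lookup m Y * variable Z ^ Poly_Mapping.lookup m Z
        = (monomial m :: 'a poly3)"
      unfolding monomial_power[symmetric] monomial_add[symmetric]
      by (simp add: mk_expo_lookup[unfolded mk_expo_def])
    finally show ?thesis by (simp add: const_def monomial_def mult_single mult.commute)
  qed
  then show ?thesis by (simp add: M_act_def subst_vars_def)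
qed

lemma lookup_M_act: "Poly_Mapping.lookup (M_act e a p) m = e ^ weight a m * Poly_Mapping.lookup p m"
  unfolding M_act_eq_sum by (simp add: lookup_sum lookup_single when_def in_keys_iff)

lemma M_act_monomial_eq_iff:
  "M_act e a (monomial m) = monomial m \<longleftrightarrow> e ^ weight a m = (1 :: 'k::comm_ring_1)"
  unfolding M_act_eq_sum keys_monomial
  by (auto simp: monomial_def poly_mapping_eq_iff fun_eq_iff lookup_single when_def)

lemma comm_ring_hom_M_act: "comm_ring_hom (M_act e a :: 'k::comm_ring_1 poly3 \<Rightarrow> 'k poly3)"
  unfolding M_act_def by (rule comm_ring_hom_subst_vars)

text \<open>
  Dehomogenisation \<open>z = 1\<close>; the outer polynomial variable is \<open>x\<close> and the inner one is \<open>y\<close>.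
\<close>

definition dehom :: "'k::comm_ring_1 poly3 \<Rightarrow> 'k poly poly" where
  "dehom = pm_eval (\<lambda>c. [:[:c:]:])
     (\<lambda>m. [:0, 1:] ^ Poly_Mapping.lookup m X * [:[:0, 1:]:] ^ Poly_Mapping.lookup m Y)"

lemma comm_ring_hom_dehom: "comm_ring_hom (dehom :: 'k::comm_ring_1 poly3 \<Rightarrow> _)"
  unfolding dehom_def
proof (rule comm_ring_hom_pm_eval)
  show "comm_ring_hom (\<lambda>c::'k. [:[:c:]:])"
    by unfold_locales (auto simp: one_pCons)
qed (simp_all add: lookup_add power_add)

lemma dehom_monomial:
  "dehom (monomial m) = [:0, 1:] ^ Poly_Mapping.lookup m X * [:[:0, 1:]:] ^ Poly_Mapping.lookup m Y"
  by (simp add: dehom_def pm_eval_def monomial_def flip: one_pCons)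

text \<open>Among monomials of one degree the \<open>z\<close>-exponent is determined by the other
  two, so setting \<open>z = 1\<close> loses nothing on forms.\<close>

lemma coeff_dehom:
  assumes p: "p \<in> forms n" and m: "expo_deg m = n"
  shows "coeff (coeff (dehom p) (Poly_Mapping.lookup m X)) (Poly_Mapping.lookup m Y) = Poly_Mapping.lookup p m"
proof -
  have "coeff (coeff (dehom p) (Poly_Mapping.lookup m X)) (Poly_Mapping.lookup m Y)
      = (\<Sum>k\<in>Poly_Mapping.keys p. Poly_Mapping.lookup p k *
          (if Poly_Mapping.lookup k X = Poly_Mapping.lookup m X \<and>
            Poly_Mapping.lookup k Y = Poly_Mapping.lookup m Y then 1 else 0))"
  proof -
    have "coeff (coeff ([:[:c:]:] * q) i) j = c * coeff (coeff q i) j" for c :: 'a and q i j by simp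
    then show ?thesis unfolding dehom_def pm_eval_def coeff_sum by (simp only: coeff_monom_product)
  qed
  also have "\<dots> = (\<Sum>k\<in>Poly_Mapping.keys p. if k = m then Poly_Mapping.lookup p k else 0)"
  proof (rule sum.cong[OF refl])
    fix k assume "k \<in> Poly_Mapping.keys p"
    then have "expo_deg k = n" using p by (auto simp: forms_def)
    then have "Poly_Mapping.lookup k X = Poly_Mapping.lookup m X \<and>
        Poly_Mapping.lookup k Y = Poly_Mapping.lookup m Y \<longleftrightarrow> k = m"
      using m by (auto simp: expo_deg_eq intro: expo_eqI)
    then show "Poly_Mapping.lookup p k *
          (if Poly_Mapping.lookup k X = Poly_Mapping.lookup m X \<and>
            Poly_Mapping.lookup k Y = Poly_Mapping.lookup m Y then 1 else 0)
        = (if k = m then Poly_Mapping.lookup p k else 0)" by simp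
  qed
  also have "\<dots> = Poly_Mapping.lookup p m" by (simp add: in_keys_iff)
  finally show ?thesis .
qed

lemma dehom_eq_0_imp:
  assumes "p \<in> forms n" "dehom p = 0"
  shows "p = 0"
proof (rule ccontr)
  assume "p \<noteq> 0"
  then obtain m where m: "m \<in> Poly_Mapping.keys p" by (metis all_not_in_conv keys_eq_empty)
  then have "Poly_Mapping.lookup p m = 0"
    using coeff_dehom[OF assms(1), of m] assms by (simp add: forms_def)
  with m show False by (simp add: in_keys_iff)
qed

section \<open>Ideals and multiplication maps\<close>

interpretation ideal: Modules.module "(*) :: 'a::comm_ring_1 \<Rightarrow> 'a \<Rightarrow> 'a"
  by standard (simp_all add: distrib_left distrib_right mult.assoc)

declare ideal.scale_scale [simp del] \<comment> \<open>it reverses \<open>mult.assoc\<close>\<close>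

lemma const_add: "const (b + c) = const b + const c"
  by (simp add: const_def single_add)

lemma const_mult: "const (b * c) = const b * const c"
  by (simp add: const_def mult_single)

interpretation forms: Vector_Spaces.vector_space "\<lambda>(c::'k::field) (p::'k poly3). const c * p"
proof (rule Vector_Spaces.vector_space.intro)
  show "const 1 * p = p" for p :: "'k poly3" by (simp only: const_def single_one mult_1_left)
qed (simp_all only: const_add const_mult distrib_left distrib_right mult.assoc)

declare forms.scale_scale [simp del]

lemma single_eq_const_mult: "Poly_Mapping.single m c = const c * (monomial m :: 'k::comm_ring_1 poly3)"
  by (simp add: const_def monomial_def mult_single)

lemma poly3_eq_sum:
  "p = (\<Sum>m\<in>Poly_Mapping.keys p. const (Poly_Mapping.lookup p m) * (monomial m :: 'k::comm_ring_1 poly3))"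
  unfolding single_eq_const_mult[symmetric] by (rule poly_mapping_eq_sum_single)

lemma zero_in_forms [simp]: "0 \<in> forms n"
  by (simp add: forms_def)

lemma monomial_in_forms_iff [simp]: "monomial m \<in> forms n \<longleftrightarrow> expo_deg m = n"
  by (simp add: forms_def)

lemma variable_in_forms [simp]: "variable v \<in> forms 1"
  by (cases v) (simp_all add: variable_def expo_deg_eq lookup_single)

lemma forms_add: "p \<in> forms n \<Longrightarrow> q \<in> forms n \<Longrightarrow> p + q \<in> forms n"
  using keys_add[of p q] by (auto simp: forms_def)

lemma forms_diff: "p \<in> forms n \<Longrightarrow> q \<in> forms n \<Longrightarrow> p - q \<in> forms n"
  using keys_diff[of p q] by (auto simp: forms_def)

lemma forms_mult: "p \<in> forms m \<Longrightarrow> q \<in> forms n \<Longrightarrow> p * q \<in> forms (m + n)"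
  using keys_mult[of p q] by (fastforce simp: forms_def expo_deg_add)

lemma forms_mult_linear: "L \<in> forms 1 \<Longrightarrow> p \<in> forms n \<Longrightarrow> L * p \<in> forms (Suc n)"
  using forms_mult[of L 1 p n] by simp

lemma forms_prod:
  assumes "\<And>i. i \<in> S \<Longrightarrow> f i \<in> forms 1"
  shows "(\<Prod>i\<in>S. f i) \<in> forms (card S)"
  using assms
proof (induction S rule: infinite_finite_induct)
  case (insert x S)
  then show ?case by (simp add: forms_mult_linear)
qed (simp_all add: forms_def expo_deg_0_iff)

section \<open>Membership in monomial ideals\<close>

lemma is_ideal_ideal_gen: "is_ideal (ideal_gen S)"
  unfolding is_ideal_def ideal_gen_def by (rule ideal.subspace_span)

lemma ideal_gen_base: "x \<in> S \<Longrightarrow> x \<in> ideal_gen S"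
  unfolding ideal_gen_def by (rule ideal.span_base)

text \<open>The polynomials all of whose monomials are multiples of members of \<open>A\<close> form
  an ideal that contains the generators.\<close>

lemma keys_ideal_gen_monomials:
  assumes "p \<in> ideal_gen (monomial ` A)" and "m \<in> Poly_Mapping.keys (p :: 'k::comm_ring_1 poly3)"
  shows "\<exists>a\<in>A. \<exists>n. m = a + n"
proof -
  let ?D = "{p :: 'k poly3. \<forall>m\<in>Poly_Mapping.keys p. \<exists>a\<in>A. \<exists>n. m = a + n}"
  have "ideal.subspace ?D"
  proof (rule ideal.subspaceI)
    fix p q :: "'k poly3" assume "p \<in> ?D" "q \<in> ?D"
    then show "p + q \<in> ?D" using keys_add[of p q] by blast
  next
    fix c p :: "'k poly3" assume p: "p \<in> ?D"
    show "c * p \<in> ?D"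
    proof clarify
      fix m assume "m \<in> Poly_Mapping.keys (c * p)"
      then obtain u v where "m = u + v" "v \<in> Poly_Mapping.keys p"
        using keys_mult[of c p] by blast
      moreover then obtain a n where "a \<in> A" "v = a + n" using p by blast
      ultimately have "m = a + (u + n)" by (simp add: ac_simps)
      with \<open>a \<in> A\<close> show "\<exists>a\<in>A. \<exists>n. m = a + n" by blast
    qed
  qed simp
  moreover have "monomial ` A \<subseteq> ?D" by (auto intro!: bexI exI[of _ 0])
  ultimately have "ideal_gen (monomial ` A) \<subseteq> ?D"
    unfolding ideal_gen_def by (intro ideal.span_minimal)
  with assms show ?thesis by blast
qed

lemma in_ideal_gen_if_keys_subset:
  assumes "Poly_Mapping.keys (p :: 'k::comm_ring_1 poly3) \<subseteq> A"
  shows "p \<in> ideal_gen (monomial ` A)"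
proof -
  have "(\<Sum>m\<in>Poly_Mapping.keys p. const (Poly_Mapping.lookup p m) * monomial m) \<in> ideal_gen (monomial ` A)"
    unfolding ideal_gen_def using assms
    by (intro ideal.span_sum ideal.span_scale ideal.span_base) auto
  then show ?thesis using poly3_eq_sum[of p] by simp
qed

text \<open>In the degree of the generators a cofactor has degree 0, so each monomial of
  \<open>p\<close> must be a generator itself.\<close>

lemma form_in_ideal_gen_iff:
  assumes A: "\<And>m. m \<in> A \<Longrightarrow> expo_deg m = d" and p: "p \<in> forms d"
  shows "p \<in> ideal_gen (monomial ` A) \<longleftrightarrow> Poly_Mapping.keys (p :: 'k::comm_ring_1 poly3) \<subseteq> A"
proof
  assume *: "p \<in> ideal_gen (monomial ` A)"
  show "Poly_Mapping.keys p \<subseteq> A"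
  proof
    fix m assume m: "m \<in> Poly_Mapping.keys p"
    then obtain a n where an: "a \<in> A" "m = a + n" using keys_ideal_gen_monomials[OF *] by blast
    then have "expo_deg n = 0" using A[of a] p m by (auto simp: forms_def expo_deg_add)
    then show "m \<in> A" using an by (simp add: expo_deg_0_iff)
  qed
qed (rule in_ideal_gen_if_keys_subset)

lemma low_degree_form_in_ideal_gen:
  assumes A: "\<And>m. m \<in> A \<Longrightarrow> expo_deg m = d" and p: "p \<in> forms n" "n < d"
    and "p \<in> ideal_gen (monomial ` A)"
  shows "p = (0 :: 'k::comm_ring_1 poly3)"
proof (rule ccontr)
  assume "p \<noteq> 0"
  then obtain m where m: "m \<in> Poly_Mapping.keys p" by (metis all_not_in_conv keys_eq_empty)
  then obtain a k where "a \<in> A" "m = a + k" using keys_ideal_gen_monomials[OF assms(4)] by blast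
  then have "d \<le> expo_deg m" using A[of a] by (simp add: expo_deg_add)
  then show False using p m by (auto simp: forms_def)
qed

section \<open>Kernel and image of multiplication on classes of forms\<close>

lemma equiv_cong_forms:
  assumes "is_ideal I"
  shows "equiv (forms n) (cong_forms I n)"
proof (rule equivI)
  note sub = assms[unfolded is_ideal_def]
  show "cong_forms I n \<subseteq> forms n \<times> forms n" by (auto simp: cong_forms_def)
  show "refl_on (forms n) (cong_forms I n)"
    by (auto simp: cong_forms_def intro!: refl_onI ideal.subspace_0[OF sub])
  show "sym (cong_forms I n)"
  proof (rule symI)
    fix p q assume "(p, q) \<in> cong_forms I n"
    then show "(q, p) \<in> cong_forms I n"
      using ideal.subspace_neg[OF sub, of "p - q"] by (simp add: cong_forms_def)
  qed
  show "trans (cong_forms I n)"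
  proof (rule transI)
    fix p q r assume "(p, q) \<in> cong_forms I n" "(q, r) \<in> cong_forms I n"
    then show "(p, r) \<in> cong_forms I n"
      using ideal.subspace_add[OF sub, of "p - q" "q - r"] by (simp add: cong_forms_def)
  qed
qed

lemma cong_class_eq_iff:
  assumes "is_ideal I" "p \<in> forms n" "q \<in> forms n"
  shows "cong_forms I n `` {p} = cong_forms I n `` {q} \<longleftrightarrow> p - q \<in> I"
  using eq_equiv_class_iff[OF equiv_cong_forms[OF assms(1)] assms(2,3)] assms(2,3)
  by (simp add: cong_forms_def)

lemma mult_map_class:
  assumes I: "is_ideal I" and L: "L \<in> forms 1" and p: "p \<in> forms n"
  shows "mult_map I n L (cong_forms I n `` {p}) = cong_forms I (Suc n) `` {L * p}"
proof -
  have "cong_forms I (Suc n) `` {L * q} = cong_forms I (Suc n) `` {L * p}"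
    if "q \<in> cong_forms I n `` {p}" for q
  proof -
    have q: "q \<in> forms n" and "p - q \<in> I" using that by (auto simp: cong_forms_def)
    then have "L * (p - q) \<in> I" using I ideal.subspace_scale unfolding is_ideal_def by blast
    then have "L * p - L * q \<in> I" by (simp add: algebra_simps)
    then show ?thesis
      using cong_class_eq_iff[OF I forms_mult_linear[OF L p] forms_mult_linear[OF L q]] by simp
  qed
  moreover have "p \<in> cong_forms I n `` {p}"
    using p I ideal.subspace_0 by (auto simp: cong_forms_def is_ideal_def)
  ultimately show ?thesis unfolding mult_map_def by blast
qed

lemma inj_on_mult_map_iff:
  assumes I: "is_ideal I" and L: "L \<in> forms 1"
  shows "inj_on (mult_map I n L) (quot_piece I n) \<longleftrightarrow> (\<forall>f\<in>forms n. L * f \<in> I \<longrightarrow> f \<in> I)"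
proof
  assume inj: "inj_on (mult_map I n L) (quot_piece I n)"
  show "\<forall>f\<in>forms n. L * f \<in> I \<longrightarrow> f \<in> I"
  proof (intro ballI impI)
    fix f assume f: "f \<in> forms n" "L * f \<in> I"
    let ?c = "\<lambda>p. cong_forms I n `` {p}"
    have "mult_map I n L (?c f) = mult_map I n L (?c 0)"
      using f forms_mult_linear[OF L f(1)] by (simp add: mult_map_class[OF I L] cong_class_eq_iff[OF I])
    moreover have "?c f \<in> quot_piece I n" "?c 0 \<in> quot_piece I n"
      using f unfolding quot_piece_def by (auto intro: quotientI)
    ultimately have "?c f = ?c 0" using inj by (auto dest: inj_onD)
    then show "f \<in> I" using f cong_class_eq_iff[OF I, of f n 0] by simp
  qed
next
  assume *: "\<forall>f\<in>forms n. L * f \<in> I \<longrightarrow> f \<in> I"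
  show "inj_on (mult_map I n L) (quot_piece I n)"
  proof (rule inj_onI)
    fix c c' assume "c \<in> quot_piece I n" "c' \<in> quot_piece I n" and eq: "mult_map I n L c = mult_map I n L c'"
    then obtain p q where pq: "p \<in> forms n" "q \<in> forms n" "c = cong_forms I n `` {p}" "c' = cong_forms I n `` {q}"
      unfolding quot_piece_def by (auto elim!: quotientE)
    then have "L * p - L * q \<in> I"
      using eq forms_mult_linear[OF L] by (simp add: mult_map_class[OF I L] cong_class_eq_iff[OF I])
    then have "L * (p - q) \<in> I" by (simp add: algebra_simps)
    then have "p - q \<in> I" using * pq forms_diff by blast
    then show "c = c'" using pq cong_class_eq_iff[OF I] by simp
  qed
qed

lemma mult_map_surjD:
  assumes I: "is_ideal I" and L: "L \<in> forms 1"
    and surj: "mult_map I n L ` quot_piece I n = quot_piece I (Suc n)" and p: "p \<in> forms (Suc n)"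
  obtains q where "q \<in> forms n" "p - L * q \<in> I"
proof -
  have "cong_forms I (Suc n) `` {p} \<in> quot_piece I (Suc n)"
    using p unfolding quot_piece_def by (rule quotientI)
  then obtain c where c: "c \<in> quot_piece I n" "cong_forms I (Suc n) `` {p} = mult_map I n L c"
    unfolding surj[symmetric] by blast
  then obtain q where q: "q \<in> forms n" "c = cong_forms I n `` {q}"
    unfolding quot_piece_def by (auto elim!: quotientE)
  then have "p - L * q \<in> I"
    using c cong_class_eq_iff[OF I p forms_mult_linear[OF L q(1)]] mult_map_class[OF I L q(1)] by simp
  with q show ?thesis by (intro that)
qed

section \<open>Dimensions of graded pieces\<close>

lemma independent_monomials:
  assumes "finite M"
  shows "forms.independent (monomial ` M :: 'k::field poly3 set)"
proof (rule forms.independent_if_scalars_zero)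
  fix f :: "'k poly3 \<Rightarrow> 'k" and x :: "'k poly3" assume 0: "(\<Sum>x\<in>monomial ` M. const (f x) * x) = 0" and "x \<in> monomial ` M"
  then obtain m where m: "m \<in> M" "x = monomial m" by blast
  have "0 = Poly_Mapping.lookup (\<Sum>k\<in>M. const (f (monomial k)) * monomial k) m"
    using 0 inj_monomial by (subst (asm) sum.reindex) (auto simp: inj_on_def inj_def comp_def)
  also have "\<dots> = f x"
    using assms m by (simp add: lookup_sum lookup_single when_def flip: single_eq_const_mult)
  finally show "f x = 0" by simp
qed (use assms in simp)

text \<open>A monomial of degree \<open>n + 1\<close> is either divisible by \<open>x\<close> or one
  of the \<open>n + 2\<close> monomials in \<open>y\<close> and \<open>z\<close> alone.\<close>

lemma card_expo_deg_Suc: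
  "card {m. expo_deg m = Suc n} = card {m. expo_deg m = n} + (n + 2)"
proof -
  let ?f = "\<lambda>m. m + mk_expo 1 0 0" and ?g = "\<lambda>j. mk_expo 0 j (Suc n - j)"
  have "{m. expo_deg m = Suc n} = ?f ` {m. expo_deg m = n} \<union> ?g ` {..Suc n}"
  proof (intro equalityI subsetI)
    fix m assume "m \<in> {m. expo_deg m = Suc n}"
    then have deg: "Poly_Mapping.lookup m X + Poly_Mapping.lookup m Y + Poly_Mapping.lookup m Z = Suc n"
      by (simp add: expo_deg_eq)
    show "m \<in> ?f ` {m. expo_deg m = n} \<union> ?g ` {..Suc n}"
    proof (cases "Poly_Mapping.lookup m X")
      case 0
      then have "m = ?g (Poly_Mapping.lookup m Y)" using deg by (intro expo_eqI) auto
      then show ?thesis using deg 0 by auto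
    next
      case (Suc i)
      then have "m = ?f (mk_expo i (Poly_Mapping.lookup m Y) (Poly_Mapping.lookup m Z))"
        by (intro expo_eqI) (auto simp: lookup_add)
      then show ?thesis using deg Suc by (intro UnI1 image_eqI) auto
    qed
  qed (auto simp: expo_deg_add)
  moreover have "?f ` {m. expo_deg m = n} \<inter> ?g ` {..Suc n} = {}"
  proof -
    have "?f m \<noteq> ?g j" for m j
    proof
      assume "?f m = ?g j"
      then have "Poly_Mapping.lookup (?f m) X = Poly_Mapping.lookup (?g j) X" by (rule arg_cong)
      then show False by (simp add: lookup_add)
    qed
    then show ?thesis by blast
  qed
  moreover have "card (?f ` {m. expo_deg m = n}) = card {m. expo_deg m = n}"
    by (intro card_image inj_onI) simp
  moreover have "card (?g ` {..Suc n}) = n + 2"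
    by (subst card_image) (auto intro!: inj_onI dest: arg_cong[of _ _ "\<lambda>m. Poly_Mapping.lookup m Y"])
  ultimately show ?thesis
    using finite_expo_deg by (simp add: card_Un_disjoint)
qed

lemma mult_in_span:
  assumes "\<And>m. m \<in> Poly_Mapping.keys q \<Longrightarrow> L * monomial m \<in> forms.span G"
  shows "L * q \<in> forms.span (G :: 'k::field poly3 set)"
proof -
  have "L * q = (\<Sum>m\<in>Poly_Mapping.keys q. const (Poly_Mapping.lookup q m) * (L * monomial m))"
    by (subst poly3_eq_sum[of q], unfold sum_distrib_left) (rule sum.cong[OF refl mult.left_commute])
  also have "\<dots> \<in> forms.span G"
    using assms by (intro forms.span_sum forms.span_scale)
  finally show ?thesis .
qed

text \<open>
  At most \<open>d + 1\<close> generators make $\dim (R/I)_{d-1} \le \dim (R/I)_d$, so a kernel element also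
  rules out surjectivity.
\<close>

lemma not_mult_max_rank_if_kernel:
  fixes A :: "expo set" and f L :: "'k::field poly3"
  assumes A: "\<And>m. m \<in> A \<Longrightarrow> expo_deg m = Suc n" and card: "card A \<le> n + 2"
    and L: "L \<in> forms 1" and f: "f \<in> forms n" "f \<noteq> 0"
    and Lf: "L * f \<in> ideal_gen (monomial ` A)"
  shows "\<not> mult_max_rank (ideal_gen (monomial ` A)) n L"
proof -
  let ?I = "ideal_gen (monomial ` A) :: 'k poly3 set"
  have I: "is_ideal ?I" by (rule is_ideal_ideal_gen)
  have finA: "finite A" by (rule finite_subset[OF _ finite_expo_deg[of "Suc n"]], rule subsetI, simp add: A)
  have "f \<notin> ?I" using low_degree_form_in_ideal_gen[OF A f(1) lessI] f(2) by blast
  then have "\<not> inj_on (mult_map ?I n L) (quot_piece ?I n)"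
    unfolding inj_on_mult_map_iff[OF I L] using f Lf by blast
  moreover have "mult_map ?I n L ` quot_piece ?I n \<noteq> quot_piece ?I (Suc n)"
  proof
    assume surj: "mult_map ?I n L ` quot_piece ?I n = quot_piece ?I (Suc n)"
    \<comment> \<open>As \<open>L * f\<close> lies in \<open>?I\<close>, the product of
      \<open>L\<close> with \<open>m0\<close> is a combination of the other products and of
      \<open>?I\<close>. Without \<open>m0\<close> at most \<open>dim R_n - 1 + (n + 2)\<close>
      spanning elements remain, fewer than the dimension of \<open>R_(n+1)\<close>.\<close>
    obtain m0 where m0: "m0 \<in> Poly_Mapping.keys f" using f by (metis all_not_in_conv keys_eq_empty)
    define M where "M = {m. expo_deg m = n}"
    define G where "G = (\<lambda>m. L * monomial m) ` (M - {m0}) \<union> monomial ` A"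
    have finM: "finite M" unfolding M_def by (rule finite_expo_deg)
    have m0M: "m0 \<in> M" using m0 f by (auto simp: M_def forms_def)
    have I_span: "p \<in> forms.span G" if "p \<in> ?I" "p \<in> forms (Suc n)" for p
    proof -
      have "Poly_Mapping.keys p \<subseteq> A" using form_in_ideal_gen_iff[OF A that(2)] that(1) by simp
      then have "1 * monomial m \<in> forms.span G" if "m \<in> Poly_Mapping.keys p" for m
        using that by (auto simp: G_def intro: forms.span_base)
      then have "1 * p \<in> forms.span G" by (rule mult_in_span)
      then show ?thesis by simp
    qed
    let ?c = "Poly_Mapping.lookup f m0"
    have c: "?c \<noteq> 0" using m0 by (simp add: in_keys_iff)
    have L_span: "L * monomial m \<in> forms.span G" if m: "m \<in> M" for m
    proof (cases "m = m0")
      case True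
      let ?g = "f - Poly_Mapping.single m0 ?c"
      have "Poly_Mapping.keys ?g \<subseteq> M - {m0}"
      proof
        fix k assume "k \<in> Poly_Mapping.keys ?g"
        then have "k \<noteq> m0 \<and> k \<in> Poly_Mapping.keys f"
          by (cases "k = m0") (simp_all add: in_keys_iff lookup_minus lookup_single when_def)
        then show "k \<in> M - {m0}" using f by (simp add: forms_def M_def)
      qed
      then have "L * monomial m \<in> forms.span G" if "m \<in> Poly_Mapping.keys ?g" for m
        using that by (auto simp: G_def intro: forms.span_base)
      then have "L * ?g \<in> forms.span G" by (rule mult_in_span)
      moreover have "L * f \<in> forms.span G" by (rule I_span[OF Lf forms_mult_linear[OF L f(1)]])
      ultimately have "const (inverse ?c) * (L * f - L * ?g) \<in> forms.span G"
        by (intro forms.span_scale forms.span_diff)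
      also have "const (inverse ?c) * (L * f - L * ?g) = L * (const (inverse ?c) * Poly_Mapping.single m0 ?c)"
        by (simp add: right_diff_distrib mult.left_commute[of L])
      also have "const (inverse ?c) * Poly_Mapping.single m0 ?c = monomial m0"
        using c by (simp add: const_def monomial_def mult_single)
      finally show ?thesis using True by simp
    next
      case False
      then show ?thesis using m by (auto simp: G_def intro: forms.span_base)
    qed
    have spans: "monomial ` {m. expo_deg m = Suc n} \<subseteq> forms.span G"
    proof (rule image_subsetI)
      fix m assume "m \<in> {m. expo_deg m = Suc n}"
      then have p: "(monomial m :: 'k poly3) \<in> forms (Suc n)" by simp
      obtain q where q: "q \<in> forms n" "monomial m - L * q \<in> ?I"
        using mult_map_surjD[OF I L surj p] .
      have "L * q \<in> forms.span G"
        using q by (intro mult_in_span[of q] L_span) (auto simp: forms_def M_def)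
      moreover have "monomial m - L * q \<in> forms.span G"
        using q p L by (intro I_span forms_diff forms_mult_linear)
      ultimately have "(monomial m - L * q) + L * q \<in> forms.span G" by (intro forms.span_add)
      then show "monomial m \<in> forms.span G" by simp
    qed
    have "finite G" using finM finA by (simp add: G_def)
    from forms.independent_span_bound[OF this independent_monomials[OF finite_expo_deg] spans]
    have "card (monomial ` {m. expo_deg m = Suc n} :: 'k poly3 set) \<le> card G" ..
    also have "card G \<le> card ((\<lambda>m. L * monomial m) ` (M - {m0})) + card (monomial ` A :: 'k poly3 set)"
      unfolding G_def by (rule card_Un_le)
    also have "\<dots> \<le> card (M - {m0}) + card A"
      using finM finA by (intro add_mono card_image_le) simp_all
    also have "\<dots> < card M + (n + 2)"
      using card_Diff1_less[OF finM m0M] card by (rule add_less_le_mono)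
    also have "\<dots> = card {m. expo_deg m = Suc n}"
      by (simp add: card_expo_deg_Suc M_def)
    also have "\<dots> = card (monomial ` {m. expo_deg m = Suc n} :: 'k poly3 set)"
      by (rule card_image[OF inj_on_subset[OF inj_monomial subset_UNIV], symmetric])
    finally show False by simp
  qed
  ultimately show ?thesis by (simp add: mult_max_rank_def)
qed

section \<open>Invariant monomials\<close>

lemma subspace_eq_if_dim_le:
  assumes A: "forms.subspace A" and sub: "A \<subseteq> B"
    and B: "B \<subseteq> forms.span M" "finite M" and dim: "forms.dim B \<le> forms.dim A"
  shows "A = (B :: 'k::field poly3 set)"
proof -
  obtain C where C: "C \<subseteq> A" "forms.independent C" "A \<subseteq> forms.span C" "card C = forms.dim A"
    using forms.basis_exists[of A] by blast
  obtain D where D: "C \<subseteq> D" "D \<subseteq> B" "forms.independent D" "B \<subseteq> forms.span D"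
    using forms.maximal_independent_subset_extend[of C B] C sub by blast
  have "D \<subseteq> forms.span M" using D B by blast
  \<comment> \<open>The space of all polynomials is infinite-dimensional; the finite spanning set
    \<open>M\<close> makes equal dimensions force equality.\<close>
  then have "finite D" using forms.independent_span_bound[OF B(2) D(3)] by blast
  moreover have "card D = forms.dim B" using forms.basis_card_eq_dim[OF D(2,4,3)] .
  ultimately have "C = D" using card_seteq[of D C] D(1) C(4) dim by simp
  then have "B \<subseteq> A" using D(4) forms.span_minimal[OF C(1) A] by blast
  with sub show ?thesis by blast
qed

lemma ideal_subspace_forms: "is_ideal I \<Longrightarrow> forms.subspace I"
  unfolding is_ideal_def
  by (intro forms.subspaceI) (auto intro: ideal.subspace_0 ideal.subspace_add ideal.subspace_scale)

text \<open>
  The quotient is finite-dimensional, being spanned by the monomials with all exponents below \<open>d\<close>.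
\<close>

lemma artinian_ideal_if_powers:
  fixes I :: "'k::field poly3 set"
  assumes I: "is_ideal I" and powers: "\<And>v. monomial (Poly_Mapping.single v d) \<in> I"
  shows "artinian_ideal I"
  unfolding artinian_ideal_def
proof (intro conjI allI impI I)
  fix J :: "nat \<Rightarrow> 'k poly3 set"
  assume J: "\<forall>n. is_ideal (J n) \<and> I \<subseteq> J n \<and> J (Suc n) \<subseteq> J n"
  define M :: "'k poly3 set" where "M = monomial ` {m :: expo. \<forall>v. Poly_Mapping.lookup m v < d}"
  have exps: "{m :: expo. \<forall>v. Poly_Mapping.lookup m v < d} \<subseteq> (\<Union>n\<le>3 * d. {m. expo_deg m = n})"
  proof
    fix m :: expo assume m: "m \<in> {m. \<forall>v. Poly_Mapping.lookup m v < d}"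
    then have "Poly_Mapping.lookup m X < d" "Poly_Mapping.lookup m Y < d" "Poly_Mapping.lookup m Z < d"
      by simp_all
    then show "m \<in> (\<Union>n\<le>3 * d. {m. expo_deg m = n})" by (simp add: expo_deg_eq)
  qed
  have finM: "finite M"
    unfolding M_def by (rule finite_imageI[OF finite_subset[OF exps]]) (simp add: finite_expo_deg)
  have decomp: "\<exists>u\<in>forms.span M. p - u \<in> I" for p
  proof
    let ?t = "\<lambda>m. const (Poly_Mapping.lookup p m) * monomial m"
    let ?S = "{m :: expo. \<forall>v. Poly_Mapping.lookup m v < d}"
    let ?u = "\<Sum>m\<in>Poly_Mapping.keys p \<inter> ?S. ?t m"
    show "?u \<in> forms.span M"
      by (intro forms.span_sum forms.span_scale forms.span_base) (auto simp: M_def)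
    have "(\<Sum>m\<in>Poly_Mapping.keys p - ?S. ?t m) + ?u = p"
      using sum.Int_Diff[of "Poly_Mapping.keys p" ?t ?S, OF finite_keys] poly3_eq_sum[of p, symmetric]
      by (simp only: add.commute)
    then have "p - ?u = (\<Sum>m\<in>Poly_Mapping.keys p - ?S. ?t m)"
      by (rule add_implies_diff[symmetric])
    moreover have "?t m \<in> I" if "m \<notin> ?S" for m
    proof -
      obtain v where v: "d \<le> Poly_Mapping.lookup m v" using \<open>m \<notin> ?S\<close> by (auto simp: not_less)
      have "m = Poly_Mapping.single v d + (m - Poly_Mapping.single v d)"
        using v by (intro poly_mapping_eqI) (auto simp: lookup_add lookup_minus lookup_single when_def)
      from arg_cong[OF this, of monomial]
      have "monomial m = monomial (Poly_Mapping.single v d) * (monomial (m - Poly_Mapping.single v d) :: 'k poly3)"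
        unfolding monomial_add .
      then have "?t m = (const (Poly_Mapping.lookup p m) * monomial (m - Poly_Mapping.single v d))
          * monomial (Poly_Mapping.single v d)"
        by (simp only: mult.assoc mult.commute[of "monomial (Poly_Mapping.single v d)"])
      also have "\<dots> \<in> I"
        by (rule ideal.subspace_scale[OF I[unfolded is_ideal_def] powers])
      finally show ?thesis .
    qed
    then have "(\<Sum>m\<in>Poly_Mapping.keys p - ?S. ?t m) \<in> I"
      by (intro ideal.subspace_sum[OF I[unfolded is_ideal_def]]) blast
    ultimately show "p - ?u \<in> I" by (simp only:)
  qed
  have Jn: "forms.subspace (J k)" for k
    using J by (intro ideal_subspace_forms) simp
  \<comment> \<open>Every polynomial has a representative in \<open>span M\<close> modulo
    \<open>I\<close>, hence modulo each \<open>J n\<close>, so \<open>J n\<close> is determined by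
    its trace on this finite-dimensional space. The chain is constant from where the dimension of
    the trace is least.\<close>
  define V where "V = (\<lambda>n. J n \<inter> forms.span M)"
  have V_sub: "forms.subspace (V n)" for n
    unfolding V_def by (rule forms.subspace_inter[OF Jn forms.subspace_span])
  obtain N where N: "forms.dim (V N) \<le> forms.dim (V n)" for n
    using ex_has_least_nat[of "\<lambda>_. True" 0 "\<lambda>n. forms.dim (V n)"] by auto
  have "J n = J N" if "N \<le> n" for n
  proof
    show sub: "J n \<subseteq> J N"
      by (rule lift_Suc_antimono_le[of J, OF _ that]) (use J in simp)
    have "V n = V N"
      using sub by (intro subspace_eq_if_dim_le[OF V_sub _ _ finM N]) (auto simp: V_def)
    show "J N \<subseteq> J n"
    proof
      fix p assume p: "p \<in> J N"
      obtain u where u: "u \<in> forms.span M" "p - u \<in> I" using decomp by blast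
      have pu: "p - u \<in> J k" for k using J u by blast
      have "u \<in> J N" using forms.subspace_diff[OF Jn[of N] p pu] by simp
      then have "u \<in> J n" using u \<open>V n = V N\<close> by (auto simp: V_def)
      then show "p \<in> J n" using forms.subspace_add[OF Jn[of n] pu, of u] by simp
    qed
  qed
  then show "\<exists>N. \<forall>n\<ge>N. J n = J N" by blast
qed

section \<open>Counting invariant monomials\<close>

definition invariant_expos :: "nat \<Rightarrow> nat \<Rightarrow> expo set" where
  "invariant_expos d a = {m. expo_deg m = d \<and> d dvd weight a m}"

lemma finite_invariant_expos: "finite (invariant_expos d a)"
  by (rule finite_subset[OF _ finite_expo_deg[of d]]) (auto simp: invariant_expos_def)

lemma GT_ideal_eq:
  assumes "primitive_root_of_unity d (e :: 'k::field)"
  shows "GT_ideal d e a = ideal_gen (monomial ` invariant_expos d a)"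
  unfolding GT_ideal_def
  by (rule arg_cong[of _ _ ideal_gen])
    (auto simp: M_act_monomial_eq_iff primitive_root_power_eq_1_iff[OF assms] invariant_expos_def)

text \<open>Invariant monomials with equal \<open>z\<close>-exponent have \<open>y\<close>-exponents
  congruent modulo \<open>d\<close>. So the \<open>z\<close>-exponent, one of \<open>d + 1\<close>
  values, separates them all except \<open>x^d\<close> and \<open>y^d\<close>.\<close>

lemma card_invariant_expos:
  assumes a: "2 \<le> a" "a < d"
  shows "card (invariant_expos d a) \<le> d + 1"
proof -
  \<comment> \<open>No invariant monomial has z-exponent \<open>d - 1\<close>, so this value is free for $y^d$.\<close>
  define g where "g = (\<lambda>m :: expo. if Poly_Mapping.lookup m Y = d then d - 1 else Poly_Mapping.lookup m Z)"
  have gap: "Poly_Mapping.lookup m Z \<noteq> d - 1" if m: "m \<in> invariant_expos d a" for m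
  proof
    assume z: "Poly_Mapping.lookup m Z = d - 1"
    let ?y = "Poly_Mapping.lookup m Y"
    have y: "?y \<le> 1" using m z a by (auto simp: invariant_expos_def expo_deg_eq)
    \<comment> \<open>Modulo \<open>d\<close> the weight is \<open>y - a\<close>, which lies
      strictly between \<open>-d\<close> and 0.\<close>
    have "(?y + a * (d - 1)) + (a - ?y) = a * d"
      using y a by (cases d) auto
    moreover have "d dvd ?y + a * (d - 1)"
      using m z by (simp add: invariant_expos_def weight_def)
    ultimately have "d dvd a - ?y" by (metis dvd_add_right_iff dvd_triv_right)
    then show False using y a by (auto dest: dvd_imp_le)
  qed
  have y_eq: "Poly_Mapping.lookup m Y = Poly_Mapping.lookup k Y"
    if "m \<in> invariant_expos d a" "k \<in> invariant_expos d a" "Poly_Mapping.lookup m Z = Poly_Mapping.lookup k Z"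
      "Poly_Mapping.lookup m Y < d" "Poly_Mapping.lookup k Y \<le> Poly_Mapping.lookup m Y" for m k
  proof -
    have "weight a m = weight a k + (Poly_Mapping.lookup m Y - Poly_Mapping.lookup k Y)"
      using that by (simp add: weight_def)
    then have "d dvd Poly_Mapping.lookup m Y - Poly_Mapping.lookup k Y"
      using that by (metis (no_types, lifting) dvd_add_right_iff invariant_expos_def mem_Collect_eq)
    then show ?thesis using that by (auto dest: dvd_imp_le)
  qed
  have "inj_on g (invariant_expos d a)"
  proof (rule inj_onI)
    fix m k assume mk: "m \<in> invariant_expos d a" "k \<in> invariant_expos d a" "g m = g k"
    have deg: "Poly_Mapping.lookup m X + Poly_Mapping.lookup m Y + Poly_Mapping.lookup m Z = d"
      "Poly_Mapping.lookup k X + Poly_Mapping.lookup k Y + Poly_Mapping.lookup k Z = d"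
      using mk by (simp_all add: invariant_expos_def expo_deg_eq)
    consider "Poly_Mapping.lookup m Y = d" "Poly_Mapping.lookup k Y = d"
      | "Poly_Mapping.lookup m Y < d" "Poly_Mapping.lookup k Y < d" "Poly_Mapping.lookup m Z = Poly_Mapping.lookup k Z"
      using mk(3) gap[OF mk(1)] gap[OF mk(2)] deg by (auto simp: g_def split: if_splits)
    then show "m = k"
    proof cases
      case 1
      then show ?thesis using deg by (intro expo_eqI) auto
    next
      case 2
      then have "Poly_Mapping.lookup m Y = Poly_Mapping.lookup k Y"
        using y_eq[of m k] y_eq[of k m] mk by linarith
      then show ?thesis using 2 deg by (intro expo_eqI) auto
    qed
  qed
  moreover have "g ` invariant_expos d a \<subseteq> {..d}"
    by (auto simp: g_def invariant_expos_def expo_deg_eq)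
  ultimately have "card (invariant_expos d a) \<le> card {..d}" by (rule card_inj_on_le) simp
  then show ?thesis by simp
qed

section \<open>Orbit products of linear forms\<close>

lemma M_act_forms: "p \<in> forms n \<Longrightarrow> M_act e a p \<in> forms n"
  by (auto simp: forms_def in_keys_iff lookup_M_act)

lemma M_act_M_act: "M_act e a (M_act f a p) = M_act (e * f) a p"
  by (rule poly_mapping_eqI) (simp add: lookup_M_act power_mult_distrib mult.assoc)

lemma M_act_1: "M_act 1 a p = p"
  by (rule poly_mapping_eqI) (simp add: lookup_M_act)

text \<open>Since \<open>e^d = 1\<close>, acting by \<open>e\<close> permutes the factors
  cyclically; the product is invariant, so only invariant monomials occur in it.\<close>

lemma orbit_product_keys:
  fixes L :: "'k::field poly3" and e :: 'k
  assumes e: "primitive_root_of_unity d e" and L: "L \<in> forms 1"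
  shows "Poly_Mapping.keys (\<Prod>i<d. M_act (e ^ i) a L) \<subseteq> invariant_expos d a"
proof
  let ?P = "\<Prod>i<d. M_act (e ^ i) a L"
  interpret M: comm_ring_hom "M_act e a" by (rule comm_ring_hom_M_act)
  fix m assume m: "m \<in> Poly_Mapping.keys ?P"
  have "?P \<in> forms (card {..<d})" using L by (intro forms_prod M_act_forms)
  then have deg: "expo_deg m = d" using m by (simp add: forms_def)
  obtain n where n: "d = Suc n" using e by (cases d) (auto simp: primitive_root_of_unity_def)
  have "M_act e a ?P = (\<Prod>i<d. M_act (e ^ Suc i) a L)"
    by (simp add: M.hom_prod M_act_M_act)
  also have "\<dots> = (\<Prod>i<n. M_act (e ^ Suc i) a L) * M_act (e ^ d) a L"
    unfolding n by simp
  also have "\<dots> = M_act (e ^ 0) a L * (\<Prod>i<n. M_act (e ^ Suc i) a L)"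
    using e by (simp add: primitive_root_of_unity_def mult.commute)
  also have "\<dots> = ?P" unfolding n by (rule prod.lessThan_Suc_shift[symmetric])
  finally have "e ^ weight a m * Poly_Mapping.lookup ?P m = Poly_Mapping.lookup ?P m"
    by (metis lookup_M_act)
  then have "e ^ weight a m = 1" using m by (simp add: in_keys_iff)
  then show "m \<in> invariant_expos d a"
    using deg by (simp add: invariant_expos_def primitive_root_power_eq_1_iff[OF e])
qed

lemma kernel_element_exists:
  fixes L :: "'k::field poly3" and e :: 'k
  assumes e: "primitive_root_of_unity (Suc n) e" and L: "L \<in> forms 1"
  obtains f where "f \<in> forms n" "f \<noteq> 0" "L * f \<in> ideal_gen (monomial ` invariant_expos (Suc n) a)"
proof (cases "L = 0")
  \<comment> \<open>\<open>forms 1\<close> contains 0, for which any nonzero form is a kernel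
    element; \<open>x^n\<close> serves.\<close>
  case True
  have "(monomial (mk_expo n 0 0) :: 'k poly3) \<noteq> 0"
    by (metis keys_monomial keys_zero insert_not_empty)
  moreover have "0 \<in> ideal_gen (monomial ` invariant_expos (Suc n) a)"
    unfolding ideal_gen_def by (rule ideal.span_zero)
  ultimately show ?thesis using True by (intro that[of "monomial (mk_expo n 0 0)"]) simp_all
next
  case False
  interpret dehom: comm_ring_hom "dehom :: 'k poly3 \<Rightarrow> _" by (rule comm_ring_hom_dehom)
  \<comment> \<open>\<open>P / L\<close>: the orbit product without its factor for exponent 0. That
    it is nonzero is seen after dehomogenisation, in an integral domain.\<close>
  let ?f = "\<Prod>i<n. M_act (e ^ Suc i) a L"
  have "dehom (M_act (e ^ i) a L) \<noteq> 0" for i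
  proof
    assume "dehom (M_act (e ^ i) a L) = 0"
    then have "M_act (e ^ i) a L = 0" by (rule dehom_eq_0_imp[OF M_act_forms[OF L]])
    then have "Poly_Mapping.lookup L m = 0" for m
      using lookup_M_act[of "e ^ i" a L m] primitive_root_nonzero[OF e] by simp
    then show False using False by (simp add: poly_mapping_eq_iff fun_eq_iff)
  qed
  then have "dehom ?f \<noteq> 0" by (simp add: dehom.hom_prod del: power_Suc)
  then have "?f \<noteq> 0" by auto
  moreover have "?f \<in> forms n"
    using forms_prod[of "{..<n}" "\<lambda>i. M_act (e ^ Suc i) a L"] M_act_forms[OF L] by simp
  moreover have "L * ?f = (\<Prod>i<Suc n. M_act (e ^ i) a L)"
    unfolding prod.lessThan_Suc_shift by (simp add: M_act_1)
  then have "L * ?f \<in> ideal_gen (monomial ` invariant_expos (Suc n) a)"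
    using in_ideal_gen_if_keys_subset[OF orbit_product_keys[OF e L]] by simp
  ultimately show ?thesis by (intro that)
qed

section \<open>Multiples of \<open>x + y + z\<close> with invariant support\<close>

lemma coeff_dehom_eq_0:
  assumes p: "p \<in> forms n" and "n < i + j"
  shows "coeff (coeff (dehom p) i) j = (0 :: 'k::comm_ring_1)"
proof -
  have "coeff (coeff ([:[:c:]:] * q) i) j = c * coeff (coeff q i) j" for c :: 'k and q i j by simp
  then have "coeff (coeff (dehom p) i) j
      = (\<Sum>k\<in>Poly_Mapping.keys p. Poly_Mapping.lookup p k *
          (if Poly_Mapping.lookup k X = i \<and> Poly_Mapping.lookup k Y = j then 1 else 0))"
    unfolding dehom_def pm_eval_def coeff_sum by (simp only: coeff_monom_product)
  also have "\<dots> = 0"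
    using assms by (intro sum.neutral) (auto simp: forms_def expo_deg_eq)
  finally show ?thesis .
qed

lemma monic_norm_poly:
  "degree (norm_poly d a (e :: 'k::field)) = d" "coeff (norm_poly d a e) d = 1"
proof -
  show "degree (norm_poly d a e) = d"
    unfolding norm_poly_def by (subst degree_prod_eq_sum_degree) auto
  then have "coeff (norm_poly d a e) d = lead_coeff (norm_poly d a e)" by simp
  also have "\<dots> = 1" unfolding norm_poly_def by (simp add: lead_coeff_prod)
  finally show "coeff (norm_poly d a e) d = 1" .
qed

text \<open>\<open>g\<close> is invariant, hence divisible by every image of
  \<open>x + y + z\<close>; at \<open>z = 1\<close> each \<open>-(e^i y + e^(a i))\<close> is
  therefore a root in \<open>x\<close>. The \<open>d\<close> roots differ already in their
  coefficient of \<open>y\<close>.\<close>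

lemma dehom_eq_norm_poly_multiple:
  fixes f g :: "'k::field poly3" and e :: 'k
  assumes e: "primitive_root_of_unity d e" and g: "g \<in> forms d"
    and keys: "Poly_Mapping.keys g \<subseteq> invariant_expos d a"
    and g_eq: "g = (variable X + variable Y + variable Z) * f"
  shows "dehom g = Polynomial.smult [:Poly_Mapping.lookup g (mk_expo d 0 0):] (norm_poly d a e)"
proof -
  interpret dehom: comm_ring_hom "dehom :: 'k poly3 \<Rightarrow> _" by (rule comm_ring_hom_dehom)
  let ?L = "variable X + variable Y + variable Z :: 'k poly3" and ?c = "Poly_Mapping.lookup g (mk_expo d 0 0)"
  \<comment> \<open>The scalar is chosen to cancel \<open>x^d\<close>, so that \<open>h\<close> has
    degree below \<open>d\<close> in \<open>x\<close> but \<open>d\<close> roots.\<close>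
  define h where "h = dehom g - Polynomial.smult [:?c:] (norm_poly d a e)"
  have root_g: "poly (dehom g) (- [:e ^ (a * i), e ^ i:]) = 0" for i
  proof -
    interpret M: comm_ring_hom "M_act (e ^ i) a :: 'k poly3 \<Rightarrow> _" by (rule comm_ring_hom_M_act)
    have "M_act (e ^ i) a g = g"
    proof (rule poly_mapping_eqI)
      fix m
      have "(e ^ i) ^ weight a m = 1" if "Poly_Mapping.lookup g m \<noteq> 0"
      proof -
        have "d dvd weight a m" using that keys by (auto simp: invariant_expos_def in_keys_iff)
        then have "e ^ weight a m = 1" by (simp add: primitive_root_power_eq_1_iff[OF e])
        then show ?thesis by (metis mult.commute power_mult power_one)
      qed
      then show "Poly_Mapping.lookup (M_act (e ^ i) a g) m = Poly_Mapping.lookup g m"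
        by (cases "Poly_Mapping.lookup g m = 0") (simp_all add: lookup_M_act)
    qed
    then have "dehom g = dehom (M_act (e ^ i) a g)" by simp
    also have "\<dots> = dehom (M_act (e ^ i) a ?L) * dehom (M_act (e ^ i) a f)"
      unfolding g_eq by (simp only: M.hom_mult dehom.hom_mult)
    finally have "dehom g = dehom (M_act (e ^ i) a ?L) * dehom (M_act (e ^ i) a f)" .
    moreover have "dehom (M_act (e ^ i) a ?L) = [: [:e ^ (a * i), e ^ i:], 1:]"
    proof -
      have M_var: "M_act (e ^ i) a (variable v) = Poly_Mapping.single (Poly_Mapping.single v 1)
          ((e ^ i) ^ weight a (Poly_Mapping.single v 1))" for v
        unfolding variable_def M_act_eq_sum keys_monomial by (simp add: monomial_def)
      have "weight a (Poly_Mapping.single X 1) = 0" "weight a (Poly_Mapping.single Y 1) = 1"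
        "weight a (Poly_Mapping.single Z 1) = a"
        by (simp_all add: weight_def lookup_single)
      then show ?thesis
        by (simp add: M.hom_add dehom.hom_add M_var)
          (simp add: dehom_def pm_eval_def lookup_single power_mult mult.commute[of a] one_pCons)
    qed
    ultimately show ?thesis by simp
  qed
  have root_N: "poly (norm_poly d a e) (- [:e ^ (a * i), e ^ i:]) = 0" if "i < d" for i
    unfolding norm_poly_def poly_prod using that by (auto intro!: prod_zero)
  have "h = 0"
  proof (rule ccontr)
    assume "h \<noteq> 0"
    have "coeff h i = 0" if "d \<le> i" for i
    proof (rule poly_eqI)
      fix j
      show "coeff (coeff h i) j = coeff 0 j"
      \<comment> \<open>A form of degree \<open>d\<close> has no term with \<open>i + j > d\<close>,
        so only the constant in front of \<open>x^d\<close> remains to be compared.\<close>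
      proof (cases "i = d \<and> j = 0")
        case True
        then show ?thesis
          using coeff_dehom[OF g, of "mk_expo d 0 0"] by (simp add: h_def monic_norm_poly)
      next
        case False
        then have "coeff (coeff (dehom g) i) j = 0" using that by (intro coeff_dehom_eq_0[OF g]) auto
        moreover have "coeff (coeff (norm_poly d a e) i) j = 0"
        proof (cases "i = d")
          case True
          then show ?thesis using False by (simp add: monic_norm_poly)
        next
          case False
          then show ?thesis using that monic_norm_poly(1)[of d a e] by (simp add: coeff_eq_0)
        qed
        ultimately show ?thesis by (simp add: h_def)
      qed
    qed
    then have deg: "degree h < d" using \<open>h \<noteq> 0\<close> by (metis leading_coeff_neq_0 not_le)
    let ?r = "\<lambda>i. - [:e ^ (a * i), e ^ i:]"
    have "inj_on ?r {..<d}"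
      using primitive_root_power_inj[OF e] by (intro inj_onI) auto
    then have "d = card (?r ` {..<d})" by (simp add: card_image)
    also have "\<dots> \<le> card {x. poly h x = 0}"
    proof (rule card_mono[OF poly_roots_finite[OF \<open>h \<noteq> 0\<close>]])
      show "?r ` {..<d} \<subseteq> {x. poly h x = 0}"
        using root_g root_N by (auto simp: h_def simp del: minus_pCons)
    qed
    also have "\<dots> \<le> degree h" using card_poly_roots_bound[OF \<open>h \<noteq> 0\<close>] .
    finally show False using deg by simp
  qed
  then show ?thesis by (simp add: h_def)
qed

text \<open>The product is a scalar multiple of the orbit product, whose support contains every
  invariant monomial; one missing monomial forces the scalar to be 0.\<close>

lemma linear_form_mult_injective:
  fixes f :: "'k::field_char_0 poly3" and e :: 'k
  assumes e: "primitive_root_of_unity (Suc n) e" and a: "2 \<le> a" "a < Suc n"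
    and f: "f \<in> forms n"
    and keys: "Poly_Mapping.keys ((variable X + variable Y + variable Z) * f) \<subset> invariant_expos (Suc n) a"
  shows "f = 0"
proof -
  interpret dehom: comm_ring_hom "dehom :: 'k poly3 \<Rightarrow> _" by (rule comm_ring_hom_dehom)
  let ?L = "variable X + variable Y + variable Z :: 'k poly3"
  define g where "g = ?L * f"
  have L: "?L \<in> forms 1" by (intro forms_add variable_in_forms)
  have g: "g \<in> forms (Suc n)" unfolding g_def by (rule forms_mult_linear[OF L f])
  let ?c = "Poly_Mapping.lookup g (mk_expo (Suc n) 0 0)"
  have eq: "dehom g = Polynomial.smult [:?c:] (norm_poly (Suc n) a e)"
    using keys by (intro dehom_eq_norm_poly_multiple[OF e g _ g_def]) (auto simp: g_def)
  obtain m where m: "m \<in> invariant_expos (Suc n) a" "m \<notin> Poly_Mapping.keys g"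
    using keys unfolding g_def by blast
  have deg: "expo_deg m = Suc n" and dvd: "Suc n dvd weight a m"
    using m by (auto simp: invariant_expos_def)
  have "0 = coeff (coeff (dehom g) (Poly_Mapping.lookup m X)) (Poly_Mapping.lookup m Y)"
    using coeff_dehom[OF g deg] m by (simp add: in_keys_iff)
  also have "\<dots> = ?c * coeff (coeff (norm_poly (Suc n) a e) (Poly_Mapping.lookup m X)) (Poly_Mapping.lookup m Y)"
    unfolding eq by simp
  finally have "?c = 0"
    using coeff_norm_poly_nonzero[OF e a deg[unfolded expo_deg_eq] dvd[unfolded weight_def]] by simp
  then have "dehom ?L * dehom f = 0" using eq by (simp add: g_def dehom.hom_mult)
  moreover have "dehom ?L = [:[:1, 1:], 1:]"
    by (simp add: dehom.hom_add variable_def dehom_monomial lookup_single one_pCons)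
  then have "dehom ?L \<noteq> 0" by simp
  ultimately have "dehom f = 0" by (metis mult_eq_0_iff)
  then show ?thesis by (rule dehom_eq_0_imp[OF f])
qed

section \<open>The Togliatti property and its loss for fewer generators\<close>

lemma GT_ideal_togliatti:
  fixes e :: "'k::field_char_0"
  assumes e: "primitive_root_of_unity d e" and a: "2 \<le> a" "a < d"
  shows "togliatti_system d (ideal_gen (monomial ` invariant_expos d a) :: 'k poly3 set)"
proof -
  let ?A = "invariant_expos d a"
  let ?I = "ideal_gen (monomial ` ?A) :: 'k poly3 set"
  obtain n where n: "d = Suc n" using a by (cases d) auto
  have deg: "expo_deg m = Suc n" if "m \<in> ?A" for m using that n by (simp add: invariant_expos_def)
  have card: "card ?A \<le> n + 2" using card_invariant_expos[OF a] n by simp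
  have "\<exists>F. finite F \<and> card F \<le> d + 1 \<and> F \<subseteq> forms d \<and> ?I = ideal_gen F"
  proof (intro exI conjI)
    show "finite (monomial ` ?A :: 'k poly3 set)" by (rule finite_imageI[OF finite_invariant_expos])
    show "card (monomial ` ?A :: 'k poly3 set) \<le> d + 1"
      by (rule order.trans[OF card_image_le[OF finite_invariant_expos] card_invariant_expos[OF a]])
    show "(monomial ` ?A :: 'k poly3 set) \<subseteq> forms d" by (auto simp: invariant_expos_def)
  qed (rule refl)
  moreover have "artinian_ideal ?I"
  proof (rule artinian_ideal_if_powers[OF is_ideal_ideal_gen])
    fix v
    have "Poly_Mapping.single v d \<in> ?A"
      by (cases v) (simp_all add: invariant_expos_def expo_deg_eq weight_def lookup_single)
    then show "monomial (Poly_Mapping.single v d) \<in> ?I" by (intro ideal_gen_base) blast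
  qed
  moreover have "\<not> mult_max_rank ?I (d - 1) L" if L: "L \<in> forms 1" for L
  proof -
    obtain f where f: "f \<in> forms n" "f \<noteq> 0" "L * f \<in> ?I"
      using kernel_element_exists[OF e[unfolded n] L] n by metis
    have "\<not> mult_max_rank ?I n L"
      by (rule not_mult_max_rank_if_kernel[OF deg card L f])
    then show ?thesis using n by simp
  qed
  ultimately show ?thesis using a unfolding togliatti_system_def by auto
qed

text \<open>A Togliatti system must fail maximal rank for every linear form, so injectivity for
  \<open>x + y + z\<close> alone refutes it.\<close>

lemma not_togliatti_if_proper_subset:
  fixes e :: "'k::field_char_0"
  assumes e: "primitive_root_of_unity d e" and a: "2 \<le> a" "a < d" and B: "B \<subset> invariant_expos d a"
  shows "\<not> togliatti_system d (ideal_gen (monomial ` B) :: 'k poly3 set)"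
proof -
  obtain n where n: "d = Suc n" using a by (cases d) auto
  let ?L = "variable X + variable Y + variable Z :: 'k poly3"
  have L: "?L \<in> forms 1" by (intro forms_add variable_in_forms)
  have deg: "expo_deg m = Suc n" if "m \<in> B" for m using that n B by (auto simp: invariant_expos_def)
  have "f \<in> ideal_gen (monomial ` B)" if f: "f \<in> forms n" "?L * f \<in> ideal_gen (monomial ` B)" for f
  proof -
    have "Poly_Mapping.keys (?L * f) \<subseteq> B"
      using form_in_ideal_gen_iff[OF deg forms_mult_linear[OF L f(1)]] f(2) by blast
    then have "f = 0"
      using B unfolding n by (intro linear_form_mult_injective[OF e[unfolded n] a[unfolded n] f(1)]) blast
    then show ?thesis by (simp add: ideal_gen_def ideal.span_zero)
  qed
  then have "mult_max_rank (ideal_gen (monomial ` B)) n ?L"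
    unfolding mult_max_rank_def inj_on_mult_map_iff[OF is_ideal_ideal_gen L] by blast
  then show ?thesis using L n unfolding togliatti_system_def by auto
qed

text \<open>Distinct monomials of one degree do not divide each other, so none is redundant.\<close>

lemma minimal_monomial_generators_if_equal_degree:
  assumes deg: "\<And>m. m \<in> A \<Longrightarrow> expo_deg m = d"
  shows "minimal_monomial_generators (monomial ` A) (ideal_gen (monomial ` A) :: 'k::field poly3 set)"
  unfolding minimal_monomial_generators_def
proof (intro conjI allI impI notI)
  fix N :: "'k poly3 set" assume N: "N \<subset> monomial ` A" and eq: "ideal_gen N = ideal_gen (monomial ` A)"
  then obtain B where B: "N = monomial ` B" "B \<subseteq> A" by (metis psubset_imp_subset subset_imageE)
  obtain m where m: "m \<in> A" "m \<notin> B" using N B by blast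
  have "(monomial m :: 'k poly3) \<in> ideal_gen (monomial ` B)"
    unfolding B(1)[symmetric] eq using m by (intro ideal_gen_base) blast
  then have "Poly_Mapping.keys (monomial m :: 'k poly3) \<subseteq> B"
    using form_in_ideal_gen_iff[of B d "monomial m :: 'k poly3"] deg B(2) m(1) by (simp add: subset_iff)
  with m show False by simp
qed auto

theorem theorem4p5:
  fixes d a :: nat
    and e :: "'k::{alg_closed_field, field_char_0}"
    and I :: "'k poly3 set"
  assumes "3 \<le> d"
    and "primitive_root_of_unity d e"
    and "2 \<le> a" and "a \<le> d - 1"
    and "I = GT_ideal d e a"
  shows "minimal_togliatti_system d I"
proof -
  let ?A = "invariant_expos d a"
  have a: "2 \<le> a" "a < d" using assms(1,3,4) by auto
  have I: "I = ideal_gen (monomial ` ?A)"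
    unfolding assms(5) by (rule GT_ideal_eq[OF assms(2)])
  have "monomial_togliatti_system d I"
    unfolding monomial_togliatti_system_def I
  proof (intro conjI exI)
    show "monomial ` ?A \<subseteq> range monomial" by (rule image_mono[OF subset_UNIV])
  qed (rule GT_ideal_togliatti[OF assms(2) a] refl)+
  moreover have "minimal_monomial_generators (monomial ` ?A) I"
    unfolding I by (rule minimal_monomial_generators_if_equal_degree[of _ d]) (simp add: invariant_expos_def)
  moreover have "\<forall>N. N \<subset> monomial ` ?A \<longrightarrow> \<not> monomial_togliatti_system d (ideal_gen N :: 'k poly3 set)"
  proof (intro allI impI)
    fix N :: "'k poly3 set" assume N: "N \<subset> monomial ` ?A"
    then obtain B where B: "N = monomial ` B" "B \<subseteq> ?A" by (metis psubset_imp_subset subset_imageE)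
    then have "B \<subset> ?A" using N by blast
    from not_togliatti_if_proper_subset[OF assms(2) a this]
    show "\<not> monomial_togliatti_system d (ideal_gen N)"
      unfolding monomial_togliatti_system_def B(1) by simp
  qed
  ultimately show ?thesis
    unfolding minimal_togliatti_system_def by (intro conjI exI)
qed

end
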